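(* Let $n\ge 0$ and $0\le m\le n+1$ be integers. Then: (1) Every non null-symmetric monomial $u=\theta_{a_1}\cdots\theta_{a_m}x_{b_1}\cdots x_{b_n}$ (regarded as a word with coefficient $1$ and with $a_1,\dots,a_m$ pairwise distinct) belongs to $M(\sigma\triangleright I)$ for a unique pair $(\sigma,I)$ with $\sigma\in\mathfrak S_m$ and $I\in s\mathcal P_{n,m}$. (2) The set $\{m_{\sigma\triangleright I}\mid \sigma\in\mathfrak S_m,\ I\in s\mathcal P_{n,m}\}$ spans $\mathbf{sNCSym}_{n,m}$. (3) For every $I\in s\mathcal P_{n,m}$ and $\sigma\in\mathfrak S_m$, $m_{\sigma\triangleright I}=(-1)^{\mathrm{inv}(\sigma)}m_I$. (4) The set $\{m_I\mid I\in s\mathcal P_{n,m}\}$ is a basis of the $\mathbb Q$-vector space $\mathbf{sNCSym}_{n,m}$.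
   Context: Combinatorial objects. $[n]=\{1,\dots,n\}$, $[n]_0=[n]\cup\{0\}$, and $A^+=A\setminus\{0\}$. $\mathfrak S_m$ is the group of permutations of $[m]$ and $\mathrm{inv}(\sigma)$ is the number of inversions of $\sigma$. For $0\le m\le n+1$, a partial set supercomposition of bidegree $(n,m)$ (degree $n$, fermionic degree $m$) is a tuple $K=(K_1,\dots,K_q)$ of nonempty subsets of $[n]_0$ (blocks) such that $K_1^+\cup\dots\cup K_q^+=[n]$, $K_i\cap K_j\subseteq\{0\}$ for $i\ne j$, $0\in K_i$ exactly for $i\le m$ (these are the fermionic blocks), and the nonfermionic blocks $K_{m+1},\dots,K_q$ are ordered by increasing minimum. $s\mathcal C_{n,m}$ is the set of these. A set superpartition is a partial set supercomposition $I=(I_1,\dots,I_k)$ with $I_i\ne I_j$ and $\min(I_i\setminus I_j)<\min(I_j\setminus I_i)$ for all $i<j$, where $\min(\emptyset):=0$. $s\mathcal P_{n,m}$ is the set of set superpartitions of bidegree $(n,m)$. For $\sigma\in\mathfrak S_m$ and $K\in s\mathcal C_{n,m}$, $\sigma\triangleright K=(K_{\sigma(1)},\dots,K_{\sigma(m)},K_{m+1},\dots,K_q)$. Functions. Let $\mathcal A$ be the $\mathbb Q$-algebra of formal power series of bounded degree in variables $x_1,x_2,\dots$ and $\theta_1,\theta_2,\dots$ subject only to $x_i\theta_j=\theta_jx_i$ and $\theta_i\theta_j=-\theta_j\theta_i$ for all $i,j$ (so $\theta_i^2=0$ and the $x_i$ do not commute with each other). A permutation $s\in\mathfrak S_N$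 acts on $\mathcal A$ by $x_i\mapsto x_{s(i)}$, $\theta_i\mapsto\theta_{s(i)}$ (with $s(i)=i$ for $i>N$); $f\in\mathcal A$ is symmetric if it is fixed by $\mathfrak S_N$ for all $N$. $\mathbf{sNCSym}$ is the subalgebra of symmetric elements and $\mathbf{sNCSym}_{n,m}$ its subspace of elements all of whose monomials contain exactly $n$ $x$-variables and $m$ $\theta$-variables. A monomial $\theta_{a_1}\cdots\theta_{a_m}x_{b_1}\cdots x_{b_n}$ is null-symmetric if $\{a_1,\dots,a_m\}\setminus\{b_1,\dots,b_n\}$ has more than one element. For $K\in s\mathcal C_{n,m}$, $M(K)$ is the set of all words $\theta_{a_1}\cdots\theta_{a_m}x_{b_1}\cdots x_{b_n}$ with positive integer indices such that: for $i\in[m]$, $a_i=b_j$ if and only if $j\in K_i^+$; and for $i,j\in[n]$, $b_i=b_j$ if and only if $i,j$ lie in the same block of $K$. The monomial function $m_K$ is the sum in $\mathcal A$ of all words in $M(K)$. *)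

theory Defs
  imports Complex_Main "HOL-Combinatorics.Permutations"
begin

text \<open>
  Modulo the relations, every nonzero word in the variables equals, up to sign, exactly one
  normally ordered monomial $\theta_{t_1} \cdots \theta_{t_k} x_{c_1} \cdots x_{c_l}$ with
  $t_1 < \dots < t_k$. An element of the algebra is therefore given by its coefficients
  \<open>coeff f T c\<close> at these monomials, where \<open>T = {t\<^sub>1, \<dots>, t\<^sub>k}\<close> and \<open>c = [c\<^sub>1, \<dots>, c\<^sub>l]\<close>.
  The variables are indexed by the positive integers.
\<close>

definition is_series :: "(nat set \<Rightarrow> nat list \<Rightarrow> rat) \<Rightarrow> bool" where
  "is_series f \<longleftrightarrow>
     (\<forall>T c. f T c \<noteq> 0 \<longrightarrow> finite T \<and> 0 \<notin> T \<and> 0 \<notin> set c) \<and>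
     (\<exists>d. \<forall>T c. f T c \<noteq> 0 \<longrightarrow> card T + length c \<le> d)"

typedef superseries = "{f. is_series f}"
  morphisms coeff Abs_superseries
  by (rule exI[of _ "\<lambda>_ _. 0"]) (simp add: is_series_def)

setup_lifting type_definition_superseries

lemma superseries_eqI: "(\<And>T c. coeff f T c = coeff g T c) \<Longrightarrow> f = g"
  by (metis coeff_inject ext)

text \<open>
  For disjoint \<open>S\<close> and \<open>T\<close>, sorting the product of the normally ordered $\theta_S$ and
  $\theta_T$ gives $\theta_S \theta_T = (-1)^{k} \theta_{S \cup T}$, where $k$ counts the pairs
  that have to be exchanged.
\<close>

definition merge_sign :: "nat set \<Rightarrow> nat set \<Rightarrow> rat" where
  "merge_sign S T = (-1) ^ card {(s, t). s \<in> S \<and> t \<in> T \<and> t < s}"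

type_synonym nmon = "nat set \<times> nat list"

definition splits :: "nat set \<Rightarrow> nat list \<Rightarrow> (nmon \<times> nmon) set" where
  "splits T c = {((S, u), (S', v)). S \<union> S' = T \<and> S \<inter> S' = {} \<and> u @ v = c}"

lemma finite_splits: "finite T \<Longrightarrow> finite (splits T c)"
proof -
  assume "finite T"
  have "splits T c \<subseteq> (Pow T \<times> (\<lambda>i. take i c) ` {..length c}) \<times> (Pow T \<times> (\<lambda>i. drop i c) ` {..length c})"
  proof
    fix z assume "z \<in> splits T c"
    then obtain S u S' v where z: "z = ((S, u), (S', v))" "S \<union> S' = T" "u @ v = c"
      by (auto simp: splits_def)
    hence "u = take (length u) c" "v = drop (length u) c" "length u \<le> length c" by auto
    thus "z \<in> (Pow T \<times> (\<lambda>i. take i c) ` {..length c}) \<times> (Pow T \<times> (\<lambda>i. drop i c) ` {..length c})"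
      using z by blast
  qed
  thus ?thesis using \<open>finite T\<close> by (auto intro: finite_subset)
qed

lemma finite_splitsD:
  assumes "finite T" "z \<in> splits T c"
  shows "finite (fst (fst z))" "finite (fst (snd z))"
  using assms by (auto simp: splits_def)

lemma is_series_plus:
  assumes f: "is_series f" and g: "is_series g"
  shows "is_series (\<lambda>T c. f T c + g T c)"
  unfolding is_series_def
proof
  have nz: "f T c + g T c \<noteq> 0 \<Longrightarrow> f T c \<noteq> 0 \<or> g T c \<noteq> 0" for T c by auto
  show "\<forall>T c. f T c + g T c \<noteq> 0 \<longrightarrow> finite T \<and> 0 \<notin> T \<and> 0 \<notin> set c"
    using f g nz unfolding is_series_def by blast
  obtain d where d: "\<And>T c. f T c \<noteq> 0 \<Longrightarrow> card T + length c \<le> d" using f unfolding is_series_def by blast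
  obtain e where e: "\<And>T c. g T c \<noteq> 0 \<Longrightarrow> card T + length c \<le> e" using g unfolding is_series_def by blast
  show "\<exists>d. \<forall>T c. f T c + g T c \<noteq> 0 \<longrightarrow> card T + length c \<le> d"
  proof (intro exI[of _ "d + e"] allI impI)
    fix T c assume "f T c + g T c \<noteq> 0"
    hence "f T c \<noteq> 0 \<or> g T c \<noteq> 0" by (rule nz)
    thus "card T + length c \<le> d + e"
    proof
      assume "f T c \<noteq> 0" thus ?thesis using d by (simp add: trans_le_add1)
    next
      assume "g T c \<noteq> 0" thus ?thesis using e by (simp add: trans_le_add2)
    qed
  qed
qed

lemma is_series_times:
  assumes f: "is_series f" and g: "is_series g"
  shows "is_series (\<lambda>T c. \<Sum>((S, u), (S', v)) \<in> splits T c. merge_sign S S' * f S u * g S' v)"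
  unfolding is_series_def
proof
  let ?p = "\<lambda>T c. \<Sum>((S, u), (S', v)) \<in> splits T c. merge_sign S S' * f S u * g S' v"
  have nz: "\<exists>S u S' v. S \<union> S' = T \<and> S \<inter> S' = {} \<and> u @ v = c \<and> f S u \<noteq> 0 \<and> g S' v \<noteq> 0"
    if p: "?p T c \<noteq> 0" for T c
  proof -
    have "\<exists>z \<in> splits T c. (\<lambda>((S, u), (S', v)). merge_sign S S' * f S u * g S' v) z \<noteq> 0"
      using p sum.neutral by (metis (no_types, lifting))
    then obtain z where "z \<in> splits T c"
      "(\<lambda>((S, u), (S', v)). merge_sign S S' * f S u * g S' v) z \<noteq> 0" by (elim bexE)
    moreover obtain S u S' v where "z = ((S, u), (S', v))" by (metis surj_pair)
    ultimately have "S \<union> S' = T" "S \<inter> S' = {}" "u @ v = c" "f S u \<noteq> 0" "g S' v \<noteq> 0"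
      by (simp_all add: splits_def)
    thus ?thesis by (intro exI conjI)
  qed
  show "\<forall>T c. ?p T c \<noteq> 0 \<longrightarrow> finite T \<and> 0 \<notin> T \<and> 0 \<notin> set c"
  proof (intro allI impI)
    fix T c assume "?p T c \<noteq> 0"
    from nz[OF this] obtain S u S' v where *: "S \<union> S' = T" "u @ v = c" "f S u \<noteq> 0" "g S' v \<noteq> 0"
      by (elim exE conjE)
    have "finite S \<and> 0 \<notin> S \<and> 0 \<notin> set u" "finite S' \<and> 0 \<notin> S' \<and> 0 \<notin> set v"
      using f g *(3,4) unfolding is_series_def by simp_all
    thus "finite T \<and> 0 \<notin> T \<and> 0 \<notin> set c" using *(1,2) by auto
  qed
  obtain d where d: "\<And>T c. f T c \<noteq> 0 \<Longrightarrow> card T + length c \<le> d" using f unfolding is_series_def by blast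
  obtain e where e: "\<And>T c. g T c \<noteq> 0 \<Longrightarrow> card T + length c \<le> e" using g unfolding is_series_def by blast
  show "\<exists>d. \<forall>T c. ?p T c \<noteq> 0 \<longrightarrow> card T + length c \<le> d"
  proof (intro exI[of _ "d + e"] allI impI)
    fix T c assume "?p T c \<noteq> 0"
    from nz[OF this] obtain S u S' v where *: "S \<union> S' = T" "u @ v = c" "f S u \<noteq> 0" "g S' v \<noteq> 0"
      by (elim exE conjE)
    have "card T \<le> card S + card S'" using card_Un_le[of S S'] *(1) by simp
    moreover have "length c = length u + length v" using * by auto
    ultimately show "card T + length c \<le> d + e" using d[OF *(3)] e[OF *(4)] by linarith
  qed
qed

instantiation superseries :: "{zero, one, plus, minus, uminus, times}"
begin

lift_definition zero_superseries :: superseries is "\<lambda>_ _. 0" by (simp add: is_series_def)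

lift_definition one_superseries :: superseries is "\<lambda>T c. if T = {} \<and> c = [] then 1 else 0"
  by (auto simp: is_series_def intro!: exI[of _ 0])

lift_definition uminus_superseries :: "superseries \<Rightarrow> superseries" is "\<lambda>f T c. - f T c" by (simp add: is_series_def)

lift_definition plus_superseries :: "superseries \<Rightarrow> superseries \<Rightarrow> superseries"
  is "\<lambda>f g T c. f T c + g T c"
  by (rule is_series_plus)

definition minus_superseries :: "superseries \<Rightarrow> superseries \<Rightarrow> superseries"
  where "minus_superseries f g = f + (- g)"

lift_definition times_superseries :: "superseries \<Rightarrow> superseries \<Rightarrow> superseries"
  is "\<lambda>f g T c. \<Sum>((S, u), (S', v)) \<in> splits T c. merge_sign S S' * f S u * g S' v"
  by (rule is_series_times)

instance ..

end

lemma coeff_infinite: "infinite T \<Longrightarrow> coeff f T c = 0"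
  using coeff[of f] by (auto simp: is_series_def)

lemma coeff_mult:
  "coeff (f * g) T c = (\<Sum>((S, u), (S', v)) \<in> splits T c. merge_sign S S' * coeff f S u * coeff g S' v)"
  by transfer simp

lemma coeff_simps [simp]:
  "coeff 0 T c = 0" "coeff (f + g) T c = coeff f T c + coeff g T c"
  "coeff (- f) T c = - coeff f T c" "coeff (f - g) T c = coeff f T c - coeff g T c"
  "coeff 1 T c = (if T = {} \<and> c = [] then 1 else 0)"
  by (simp_all add: minus_superseries_def zero_superseries.rep_eq plus_superseries.rep_eq
      uminus_superseries.rep_eq one_superseries.rep_eq)

lemma merge_sign_Un_left:
  assumes "finite R" "finite S" "finite T" "R \<inter> S = {}"
  shows "merge_sign (R \<union> S) T = merge_sign R T * merge_sign S T"
proof -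
  let ?A = "\<lambda>S. {(s, t). s \<in> S \<and> t \<in> T \<and> t < s}"
  have "finite (?A R)" "finite (?A S)"
    by (rule finite_subset[of _ "R \<times> T"] finite_subset[of _ "S \<times> T"]; use assms in auto)+
  moreover have "?A (R \<union> S) = ?A R \<union> ?A S" "?A R \<inter> ?A S = {}" using assms by auto
  ultimately have "card (?A (R \<union> S)) = card (?A R) + card (?A S)" by (simp add: card_Un_disjoint)
  thus ?thesis unfolding merge_sign_def by (simp only: power_add)
qed

lemma merge_sign_Un_right:
  assumes "finite R" "finite S" "finite T" "S \<inter> T = {}"
  shows "merge_sign R (S \<union> T) = merge_sign R S * merge_sign R T"
proof -
  let ?A = "\<lambda>T. {(s, t). s \<in> R \<and> t \<in> T \<and> t < s}"
  have "finite (?A S)" "finite (?A T)"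
    by (rule finite_subset[of _ "R \<times> S"] finite_subset[of _ "R \<times> T"]; use assms in auto)+
  moreover have "?A (S \<union> T) = ?A S \<union> ?A T" "?A S \<inter> ?A T = {}" using assms by auto
  ultimately have "card (?A (S \<union> T)) = card (?A S) + card (?A T)" by (simp add: card_Un_disjoint)
  thus ?thesis unfolding merge_sign_def by (simp only: power_add)
qed

lemma minus_one_power_cases: "(-1 :: rat) ^ k = 1 \<or> (-1 :: rat) ^ k = -1"
  by (cases "even k") simp_all

lemma merge_sign_empty [simp]: "merge_sign {} T = 1" "merge_sign S {} = 1"
  by (simp_all add: merge_sign_def)

instance superseries :: ring_1
proof
  fix f g h :: superseries
  show "f + g + h = f + (g + h)" "f + g = g + f" "0 + f = f" "- f + f = 0" "f - g = f + - g"
    by (rule superseries_eqI, simp add: algebra_simps)+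
  show "(0::superseries) \<noteq> 1"
    by (metis coeff_simps(1,5) zero_neq_one)
  show "(f + g) * h = f * h + g * h" "f * (g + h) = f * g + f * h"
    by (rule superseries_eqI, simp add: coeff_mult sum.distrib[symmetric] case_prod_unfold algebra_simps)+
  show "1 * f = f"
  proof (rule superseries_eqI)
    fix T c
    show "coeff (1 * f) T c = coeff f T c"
    proof (cases "finite T")
      case True
      have "coeff (1 * f) T c = (\<Sum>z \<in> {(({} :: nat set, [] :: nat list), (T, c))}. coeff f T c)"
        unfolding coeff_mult
        by (rule sum.mono_neutral_cong_right[OF finite_splits[OF True]])
          (auto simp: splits_def split: if_splits)
      thus ?thesis by simp
    qed (simp add: coeff_infinite)
  qed
  show "f * 1 = f"
  proof (rule superseries_eqI)
    fix T c
    show "coeff (f * 1) T c = coeff f T c"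
    proof (cases "finite T")
      case True
      have "coeff (f * 1) T c = (\<Sum>z \<in> {((T, c), ({} :: nat set, [] :: nat list))}. coeff f T c)"
        unfolding coeff_mult
        by (rule sum.mono_neutral_cong_right[OF finite_splits[OF True]])
          (auto simp: splits_def split: if_splits)
      thus ?thesis by simp
    qed (simp add: coeff_infinite)
  qed
  show "f * g * h = f * (g * h)"
  proof (rule superseries_eqI)
    fix T c
    show "coeff (f * g * h) T c = coeff (f * (g * h)) T c"
    proof (cases "finite T")
      case True
      define G :: "(nmon \<times> nmon) \<times> (nmon \<times> nmon) \<Rightarrow> rat" where "G = (\<lambda>(z, y).
              merge_sign (fst (fst z)) (fst (snd z)) *
              (merge_sign (fst (fst y)) (fst (snd y)) * coeff f (fst (fst y)) (snd (fst y))
                * coeff g (fst (snd y)) (snd (snd y))) * coeff h (fst (snd z)) (snd (snd z)))"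
      define H :: "(nmon \<times> nmon) \<times> (nmon \<times> nmon) \<Rightarrow> rat" where "H = (\<lambda>(z, y).
              merge_sign (fst (fst z)) (fst (snd z)) * coeff f (fst (fst z)) (snd (fst z)) *
              (merge_sign (fst (fst y)) (fst (snd y)) * coeff g (fst (fst y)) (snd (fst y))
                * coeff h (fst (snd y)) (snd (snd y))))"
      let ?A = "SIGMA z : splits T c. splits (fst (fst z)) (snd (fst z))"
      let ?B = "SIGMA z : splits T c. splits (fst (snd z)) (snd (snd z))"
      have "coeff (f * g * h) T c = (\<Sum>z \<in> splits T c. \<Sum>y \<in> splits (fst (fst z)) (snd (fst z)). G (z, y))"
        by (simp add: G_def coeff_mult case_prod_unfold sum_distrib_left sum_distrib_right)
      also have "\<dots> = sum (\<lambda>(z, y). G (z, y)) ?A"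
        by (rule sum.Sigma) (auto intro!: finite_splits simp: True dest: finite_splitsD[OF True])
      also have "\<dots> = sum G ?A" by simp
      also have "\<dots> = sum H ?B"
      proof -
        define i :: "(nmon \<times> nmon) \<times> (nmon \<times> nmon) \<Rightarrow> _"
          where "i = (\<lambda>(((R, u), _), ((S, v), (U, w))). (((R \<union> S, u @ v), (U, w)), ((R, u), (S, v))))"
        define j :: "(nmon \<times> nmon) \<times> (nmon \<times> nmon) \<Rightarrow> _"
          where "j = (\<lambda>((_, (U, w)), ((R, u), (S, v))). (((R, u), (S \<union> U, v @ w)), ((S, v), (U, w))))"
        have "H (j a) = G a" if "a \<in> ?A" for a
        proof -
          obtain Q p R S U u v w where a0: "a = (((Q, p), (U, w)), ((R, u), (S, v)))"
            by (metis surj_pair)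
          hence a: "a = (((R \<union> S, u @ v), (U, w)), ((R, u), (S, v)))"
            and d: "R \<inter> S = {}" "(R \<union> S) \<inter> U = {}" "R \<union> S \<union> U = T"
            using that by (auto simp: splits_def)
          have fin: "finite R" "finite S" "finite U" using True d by auto
          moreover have "S \<inter> U = {}" using d by auto
          ultimately show ?thesis
            by (simp add: a d G_def H_def j_def merge_sign_Un_left merge_sign_Un_right)
        qed
        moreover have "i (j a) = a" "j a \<in> ?B" if "a \<in> ?A" for a
          using that by (auto simp: i_def j_def splits_def)
        moreover have "j (i b) = b" "i b \<in> ?A" if "b \<in> ?B" for b
          using that by (auto simp: i_def j_def splits_def)
        ultimately show ?thesis by (intro sum.reindex_bij_witness[of ?A i j ?B H G])
      qed
      also have "\<dots> = sum (\<lambda>(z, y). H (z, y)) ?B" by simp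
      also have "\<dots> = (\<Sum>z \<in> splits T c. \<Sum>y \<in> splits (fst (snd z)) (snd (snd z)). H (z, y))"
        by (rule sum.Sigma[symmetric]) (auto intro!: finite_splits simp: True dest: finite_splitsD[OF True])
      also have "\<dots> = coeff (f * (g * h)) T c"
        by (simp add: H_def coeff_mult case_prod_unfold sum_distrib_left)
      finally show ?thesis .
    qed (simp add: coeff_infinite)
  qed
qed

lift_definition scale :: "rat \<Rightarrow> superseries \<Rightarrow> superseries" is "\<lambda>a f T c. a * f T c"
  unfolding is_series_def by (metis mult_zero_right)

lemma coeff_scale [simp]: "coeff (scale a f) T c = a * coeff f T c"
  by (simp add: scale.rep_eq)

global_interpretation superseries: vector_space scale
  by unfold_locales (rule superseries_eqI, simp add: algebra_simps)+

text \<open>There are no variables with index \<open>0\<close>; the dummy value there is \<open>0\<close>.\<close>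

lift_definition xvar :: "nat \<Rightarrow> superseries"
  is "\<lambda>i T c. if i \<noteq> 0 \<and> T = {} \<and> c = [i] then 1 else 0"
  by (auto simp: is_series_def intro!: exI[of _ 1])

lift_definition theta :: "nat \<Rightarrow> superseries"
  is "\<lambda>i T c. if i \<noteq> 0 \<and> T = {i} \<and> c = [] then 1 else 0"
  by (auto simp: is_series_def intro!: exI[of _ 1])

lemma coeff_mult_single:
  assumes "\<And>T c. coeff f T c = (if T = S \<and> c = u then p else 0)"
    and "\<And>T c. coeff g T c = (if T = S' \<and> c = v then q else 0)"
    and "finite S" "finite S'"
  shows "coeff (f * g) T c =
    (if T = S \<union> S' \<and> c = u @ v \<and> S \<inter> S' = {} then merge_sign S S' * p * q else 0)"
proof (cases "finite T")
  case True
  have "coeff (f * g) T c = (\<Sum>z \<in> splits T c \<inter> {((S, u), (S', v))}. merge_sign S S' * p * q)"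
    unfolding coeff_mult
    by (rule sum.mono_neutral_cong_right[OF finite_splits[OF True]])
      (auto simp: assms(1,2) split: if_splits)
  also have "\<dots> = (if ((S, u), (S', v)) \<in> splits T c then merge_sign S S' * p * q else 0)"
    by simp
  finally show ?thesis by (auto simp: splits_def)
next
  case False
  thus ?thesis using assms(3,4) by (auto simp: coeff_infinite)
qed

lemma coeff_xvar: "coeff (xvar i) T c = (if T = {} \<and> c = [i] then if i = 0 then 0 else 1 else 0)"
  by (simp add: xvar.rep_eq)

lemma coeff_theta: "coeff (theta i) T c = (if T = {i} \<and> c = [] then if i = 0 then 0 else 1 else 0)"
  by (simp add: theta.rep_eq)

lemma xvar_theta: "xvar i * theta j = theta j * xvar i"
  by (rule superseries_eqI)
    (simp add: coeff_mult_single[OF coeff_xvar coeff_theta] coeff_mult_single[OF coeff_theta coeff_xvar])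

lemma merge_sign_single: "merge_sign {i} {j} = (if j < i then -1 else 1)"
proof -
  have "{(s, t). s \<in> {i} \<and> t \<in> {j} \<and> t < s} = (if j < i then {(i, j)} else {})" by auto
  thus ?thesis by (simp add: merge_sign_def)
qed

lemma theta_theta: "theta i * theta j = - (theta j * theta i)"
  by (rule superseries_eqI)
    (auto simp: coeff_mult_single[OF coeff_theta coeff_theta] merge_sign_single)

definition monom :: "nat list \<Rightarrow> nat list \<Rightarrow> superseries" where
  "monom a b = prod_list (map theta a) * prod_list (map xvar b)"

lemma coeff_prod_theta:
  "\<exists>p. (\<forall>T c. coeff (prod_list (map theta a)) T c = (if T = set a \<and> c = [] then p else 0)) \<and>
       (if distinct a \<and> 0 \<notin> set a then p \<in> {1, -1} else p = 0)"
proof (induction a)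
  case Nil
  thus ?case by (intro exI[of _ 1]) auto
next
  case (Cons i a)
  then obtain p where p: "\<And>T c. coeff (prod_list (map theta a)) T c = (if T = set a \<and> c = [] then p else 0)"
    "if distinct a \<and> 0 \<notin> set a then p \<in> {1, -1} else p = 0" by blast
  let ?q = "if i \<in> set a \<or> i = 0 then 0 else merge_sign {i} (set a) * p"
  have sgn: "merge_sign {i} (set a) = 1 \<or> merge_sign {i} (set a) = -1"
    unfolding merge_sign_def by (rule minus_one_power_cases)
  have "coeff (prod_list (map theta (i # a))) T c = (if T = set (i # a) \<and> c = [] then ?q else 0)" for T c
    by (simp add: coeff_mult_single[OF coeff_theta p(1)])
  moreover have "if distinct (i # a) \<and> 0 \<notin> set (i # a) then ?q \<in> {1, -1} else ?q = 0"
  proof (cases "distinct a \<and> 0 \<notin> set a")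
    case True
    hence "p = 1 \<or> p = -1" using p(2) by simp
    thus ?thesis using True sgn by (elim disjE) simp_all
  next
    case False
    hence "p = 0" using p(2) by presburger
    thus ?thesis using False by simp
  qed
  ultimately show ?case by blast
qed

lemma coeff_prod_xvar:
  "coeff (prod_list (map xvar b)) T c = (if T = {} \<and> c = b then if 0 \<in> set b then 0 else 1 else 0)"
proof (induction b arbitrary: T c)
  case (Cons i b)
  show ?case by (auto simp: coeff_mult_single[OF coeff_xvar Cons.IH])
qed simp

lemma coeff_monom:
  "coeff (monom a b) T c \<noteq> 0 \<longleftrightarrow> distinct a \<and> 0 \<notin> set a \<and> 0 \<notin> set b \<and> T = set a \<and> c = b"
  "coeff (monom a b) T c \<in> {0, 1, -1}"
proof -
  obtain p where p: "\<And>T c. coeff (prod_list (map theta a)) T c = (if T = set a \<and> c = [] then p else 0)"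
    "if distinct a \<and> 0 \<notin> set a then p \<in> {1, -1} else p = 0" using coeff_prod_theta[of a] by blast
  show "coeff (monom a b) T c \<noteq> 0 \<longleftrightarrow> distinct a \<and> 0 \<notin> set a \<and> 0 \<notin> set b \<and> T = set a \<and> c = b"
    "coeff (monom a b) T c \<in> {0, 1, -1}"
    using p(2) by (auto simp: monom_def coeff_mult_single[OF p(1) coeff_prod_xvar] split: if_splits)
qed

text \<open>
  The sum of a possibly infinite family, provided that every coefficient gets only finitely many
  nonzero contributions and that the degrees are bounded.
\<close>

definition formal_sum :: "('i \<Rightarrow> superseries) \<Rightarrow> 'i set \<Rightarrow> superseries" where
  "formal_sum F I =
     Abs_superseries (\<lambda>T c. \<Sum>i \<in> {i \<in> I. coeff (F i) T c \<noteq> 0}. coeff (F i) T c)"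

lemma coeff_formal_sum:
  assumes "\<And>i T c. i \<in> I \<Longrightarrow> coeff (F i) T c \<noteq> 0 \<Longrightarrow> card T + length c \<le> d"
  shows "coeff (formal_sum F I) T c = (\<Sum>i \<in> {i \<in> I. coeff (F i) T c \<noteq> 0}. coeff (F i) T c)"
proof -
  have nz: "\<exists>i \<in> I. coeff (F i) T c \<noteq> 0"
    if "(\<Sum>i \<in> {i \<in> I. coeff (F i) T c \<noteq> 0}. coeff (F i) T c) \<noteq> 0" for T c
    using that by (metis (mono_tags, lifting) mem_Collect_eq sum.neutral)
  have sup: "finite T \<and> 0 \<notin> T \<and> 0 \<notin> set c" if "coeff (F i) T c \<noteq> 0" for i T c
    using that coeff[of "F i"] by (simp add: is_series_def)
  show ?thesis
    unfolding formal_sum_def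
  proof (subst Abs_superseries_inverse, unfold is_series_def mem_Collect_eq, intro conjI allI impI)
    show "\<exists>d. \<forall>T c. (\<Sum>i \<in> {i \<in> I. coeff (F i) T c \<noteq> 0}. coeff (F i) T c) \<noteq> 0
        \<longrightarrow> card T + length c \<le> d"
      using nz assms by blast
  qed (use nz sup in blast)+
qed

text \<open>The substitution $x_i \mapsto x_{s(i)}$, $\theta_i \mapsto \theta_{s(i)}$, monomial by monomial.\<close>

definition rename :: "(nat \<Rightarrow> nat) \<Rightarrow> superseries \<Rightarrow> superseries" where
  "rename s f = formal_sum
     (\<lambda>(T, c). scale (coeff f T c) (monom (map s (sorted_list_of_set T)) (map s c))) UNIV"

lemma coeff_rename:
  assumes "s permutes {1..N}"
  shows "coeff (rename s f) T c = coeff f (inv s ` T) (map (inv s) c) *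
    coeff (monom (map s (sorted_list_of_set (inv s ` T))) c) T c"
proof -
  let ?F = "\<lambda>(T, c). scale (coeff f T c) (monom (map s (sorted_list_of_set T)) (map s c))"
  have bij: "bij s" using assms by (rule permutes_bij)
  have inj: "inj s" using bij by (rule bij_is_inj)
  have series: "is_series (coeff f)" using coeff[of f] by simp
  then obtain d where d: "\<And>T c. coeff f T c \<noteq> 0 \<Longrightarrow> card T + length c \<le> d"
    unfolding is_series_def by blast
  have nz: "coeff f S b \<noteq> 0 \<and> T = s ` S \<and> c = map s b"
    if "coeff (?F (S, b)) T c \<noteq> 0" for S b T c
  proof -
    have "coeff f S b \<noteq> 0" "coeff (monom (map s (sorted_list_of_set S)) (map s b)) T c \<noteq> 0"
      using that by auto
    moreover from this have "finite S" using coeff_infinite by blast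
    ultimately show ?thesis by (simp add: coeff_monom(1))
  qed
  let ?z = "(inv s ` T, map (inv s) c)"
  have z: "z = ?z" if "coeff (?F z) T c \<noteq> 0" for z
  proof -
    obtain S b where "z = (S, b)" by (metis surj_pair)
    moreover from this have "T = s ` S" "c = map s b" using nz[of S b T c] that by blast+
    ultimately show ?thesis using inj by (simp add: image_image o_def)
  qed
  have "coeff (rename s f) T c = (\<Sum>z \<in> {z \<in> UNIV. coeff (?F z) T c \<noteq> 0}. coeff (?F z) T c)"
    unfolding rename_def
  proof (rule coeff_formal_sum)
    fix z T c assume "coeff (?F z) T c \<noteq> 0"
    moreover obtain S b where "z = (S, b)" by (metis surj_pair)
    ultimately have "coeff f S b \<noteq> 0" "T = s ` S" "c = map s b" using nz[of S b T c] by blast+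
    thus "card T + length c \<le> d"
      using d[of S b] inj by (simp add: card_image inj_on_subset)
  qed
  also have "\<dots> = (\<Sum>z \<in> {?z}. coeff (?F z) T c)"
    by (rule sum.mono_neutral_left) (use z in auto)
  also have "map s (map (inv s) c) = c"
    using bij by (simp add: o_def bij_is_surj surj_f_inv_f)
  hence "(\<Sum>z \<in> {?z}. coeff (?F z) T c) = coeff f (inv s ` T) (map (inv s) c) *
    coeff (monom (map s (sorted_list_of_set (inv s ` T))) c) T c" by simp
  finally show ?thesis .
qed

definition sNCSym :: "superseries set" where
  "sNCSym = {f. \<forall>N s. s permutes {1..N} \<longrightarrow> rename s f = f}"

definition sNCSym_bideg :: "nat \<Rightarrow> nat \<Rightarrow> superseries set" where
  "sNCSym_bideg n m = {f \<in> sNCSym. \<forall>T c. coeff f T c \<noteq> 0 \<longrightarrow> length c = n \<and> card T = m}"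

definition null_symmetric :: "nat list \<Rightarrow> nat list \<Rightarrow> bool" where
  "null_symmetric a b \<longleftrightarrow> card (set a - set b) > 1"

text \<open>The block $K_i$ is \<open>K ! (i - 1)\<close>.\<close>

definition supercomps :: "nat \<Rightarrow> nat \<Rightarrow> nat set list set" where
  "supercomps n m = {K.
     m \<le> length K \<and>
     (\<forall>B \<in> set K. B \<noteq> {} \<and> B \<subseteq> {0..n}) \<and>
     (\<Union>B \<in> set K. B - {0}) = {1..n} \<and>
     (\<forall>i \<in> {1..length K}. \<forall>j \<in> {1..length K}. i \<noteq> j \<longrightarrow> K ! (i - 1) \<inter> K ! (j - 1) \<subseteq> {0}) \<and>
     (\<forall>i \<in> {1..length K}. 0 \<in> K ! (i - 1) \<longleftrightarrow> i \<le> m) \<and>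
     (\<forall>i j. m < i \<and> i < j \<and> j \<le> length K \<longrightarrow> Min (K ! (i - 1)) < Min (K ! (j - 1)))}"

definition min0 :: "nat set \<Rightarrow> nat" where
  "min0 A = (if A = {} then 0 else Min A)"

definition superparts :: "nat \<Rightarrow> nat \<Rightarrow> nat set list set" where
  "superparts n m = {K \<in> supercomps n m. \<forall>i j. 1 \<le> i \<and> i < j \<and> j \<le> length K \<longrightarrow>
     K ! (i - 1) \<noteq> K ! (j - 1) \<and>
     min0 (K ! (i - 1) - K ! (j - 1)) < min0 (K ! (j - 1) - K ! (i - 1))}"

definition permute_blocks :: "nat \<Rightarrow> (nat \<Rightarrow> nat) \<Rightarrow> nat set list \<Rightarrow> nat set list" where
  "permute_blocks m \<sigma> K = map (\<lambda>i. K ! (\<sigma> i - 1)) [1..<m + 1] @ drop m K"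

definition inversions :: "nat \<Rightarrow> (nat \<Rightarrow> nat) \<Rightarrow> nat" where
  "inversions m \<sigma> = card {(i, j). 1 \<le> i \<and> i < j \<and> j \<le> m \<and> \<sigma> i > \<sigma> j}"

text \<open>
  The pair \<open>(a, b)\<close> stands for the word $\theta_{a_1} \cdots \theta_{a_m} x_{b_1} \cdots x_{b_n}$,
  kept apart from the element \<open>monom a b\<close> because distinct words can give the same element up to sign.
\<close>

definition words :: "nat \<Rightarrow> nat \<Rightarrow> nat set list \<Rightarrow> (nat list \<times> nat list) set" where
  "words n m K = {(a, b).
     length a = m \<and> length b = n \<and> 0 \<notin> set a \<and> 0 \<notin> set b \<and>
     (\<forall>i \<in> {1..m}. \<forall>j \<in> {1..n}. a ! (i - 1) = b ! (j - 1) \<longleftrightarrow> j \<in> K ! (i - 1) - {0}) \<and>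
     (\<forall>i \<in> {1..n}. \<forall>j \<in> {1..n}. b ! (i - 1) = b ! (j - 1) \<longleftrightarrow> (\<exists>B \<in> set K. i \<in> B \<and> j \<in> B))}"

definition monomial_fun :: "nat \<Rightarrow> nat \<Rightarrow> nat set list \<Rightarrow> superseries" where
  "monomial_fun n m K = formal_sum (\<lambda>(a, b). monom a b) (words n m K)"

lemma coeff_monomial_fun:
  "coeff (monomial_fun n m K) T c =
     (\<Sum>(a, b) \<in> {(a, b) \<in> words n m K. distinct a \<and> set a = T \<and> b = c}. coeff (monom a b) T c)"
proof -
  let ?F = "\<lambda>(a, b). monom a b"
  have "coeff (monomial_fun n m K) T c =
      (\<Sum>w \<in> {w \<in> words n m K. coeff (?F w) T c \<noteq> 0}. coeff (?F w) T c)"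
    unfolding monomial_fun_def
  proof (rule coeff_formal_sum)
    fix w T c assume "w \<in> words n m K" "coeff (?F w) T c \<noteq> 0"
    moreover obtain a b where "w = (a, b)" by (metis surj_pair)
    ultimately have "length a = m" "length b = n" "T = set a" "c = b"
      by (simp_all add: words_def coeff_monom(1))
    thus "card T + length c \<le> m + n" using card_length[of a] by simp
  qed
  also have "{w \<in> words n m K. coeff (?F w) T c \<noteq> 0} =
      {(a, b) \<in> words n m K. distinct a \<and> set a = T \<and> b = c}"
  proof (rule set_eqI)
    fix w :: "nat list \<times> nat list"
    obtain a b where "w = (a, b)" by (metis surj_pair)
    thus "w \<in> {w \<in> words n m K. coeff (?F w) T c \<noteq> 0} \<longleftrightarrow>
        w \<in> {(a, b) \<in> words n m K. distinct a \<and> set a = T \<and> b = c}"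
      by (simp add: coeff_monom(1)) (auto simp: words_def)
  qed
  finally show ?thesis by (simp add: case_prod_unfold)
qed

end

theory Submission
  imports Defs
begin

text \<open>
  A word $\theta_a x_b$ determines its blocks: the fermionic ones are the level sets of \<open>b\<close> at the
  entries of \<open>a\<close>, with \<open>0\<close> added, and the others are the remaining level sets. The word is not
  null-symmetric exactly when at most one fermionic block equals \<open>{0}\<close>, that is, when the minima of
  the positive parts of the fermionic blocks (read as \<open>0\<close> for \<open>{0}\<close>) are distinct; sorting by them
  gives \<open>\<sigma>\<close> and \<open>I\<close>. The words in $M(I)$ form one orbit under renaming variables, so a
  symmetric series is determined by its coefficients at one word for each \<open>I\<close>: the coefficients at
  null-symmetric words vanish because a transposition of two $\theta$-variables changes the sign.
  Evaluating at these words, the $m_I$ are dual to the coefficient functionals, which gives both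
  spanning and independence.
\<close>

section \<open>Lists sorted by an injective key\<close>

text \<open>Both key lists are the strictly increasing enumeration of one set, and the key is
  injective there, so equality lifts back. With block keys this turns equality of block sets into
  equality of block lists.\<close>

lemma sorted_wrt_key_unique:
  fixes key :: "'a \<Rightarrow> 'b::linorder"
  assumes xs: "sorted_wrt (\<lambda>x y. key x < key y) xs"
    and ys: "sorted_wrt (\<lambda>x y. key x < key y) ys"
    and eq: "set xs = set ys"
  shows "xs = ys"
proof -
  have xs': "sorted_wrt (<) (map key xs)" and ys': "sorted_wrt (<) (map key ys)"
    using xs ys by (simp_all add: sorted_wrt_map)
  have "map key xs = map key ys"
    by (rule strict_sorted_equal[OF ys' xs']) (simp add: eq)
  moreover have "inj_on key (set xs \<union> set ys)"
    using xs' eq by (simp add: strict_sorted_iff distinct_map)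
  ultimately show ?thesis by (rule map_inj_on)
qed

lemma sorted_wrt_key_distinct:
  fixes key :: "'a \<Rightarrow> 'b::linorder"
  assumes "sorted_wrt (\<lambda>x y. key x < key y) xs"
  shows "distinct xs"
proof -
  have "sorted_wrt (<) (map key xs)" using assms by (simp add: sorted_wrt_map)
  thus ?thesis by (simp add: strict_sorted_iff distinct_map)
qed

lemma ex_sorted_wrt_key:
  fixes key :: "'a \<Rightarrow> 'b::linorder"
  assumes fin: "finite S" and inj: "inj_on key S"
  obtains xs where "sorted_wrt (\<lambda>x y. key x < key y) xs" "set xs = S"
proof
  let ?l = "sorted_list_of_set (key ` S)"
  let ?xs = "map (inv_into S key) ?l"
  have "map key ?xs = ?l" using fin
    by (auto intro!: map_idI simp: f_inv_into_f)
  hence "sorted_wrt (<) (map key ?xs)" by simp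
  thus "sorted_wrt (\<lambda>x y. key x < key y) ?xs" by (simp only: sorted_wrt_map)
  show "set ?xs = S" using fin inj by simp
qed

section \<open>Permutations\<close>

text \<open>Blocks are numbered from 1 but list positions from 0, so a permutation of
  \<open>{1..m}\<close> is conjugated to one of \<open>{..<m}\<close>. The truncated subtraction
  loses nothing, since such a permutation fixes 0 and never sends \<open>Suc i\<close> to 0.\<close>

definition shift_down :: "(nat \<Rightarrow> nat) \<Rightarrow> nat \<Rightarrow> nat" where
  "shift_down \<sigma> = (\<lambda>i. \<sigma> (Suc i) - 1)"

lemma Suc_shift_down:
  assumes "\<sigma> permutes {1..m}"
  shows "Suc (shift_down \<sigma> i) = \<sigma> (Suc i)"
proof -
  have "\<sigma> (Suc i) \<noteq> 0"
  proof
    assume "\<sigma> (Suc i) = 0"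
    moreover have "\<sigma> 0 = 0" using assms by (simp add: permutes_def)
    ultimately have "Suc i = 0" using permutes_inj[OF assms] by (metis injD)
    thus False by simp
  qed
  thus ?thesis by (simp add: shift_down_def)
qed

lemma shift_down_permutes:
  assumes "\<sigma> permutes {1..m}"
  shows "shift_down \<sigma> permutes {..<m}"
proof (rule bij_imp_permutes)
  have inj: "inj_on (shift_down \<sigma>) {..<m}"
    by (rule inj_onI) (metis Suc_shift_down[OF assms] injD permutes_inj[OF assms] Suc_inject)
  have "shift_down \<sigma> ` {..<m} \<subseteq> {..<m}"
  proof
    fix y assume "y \<in> shift_down \<sigma> ` {..<m}"
    then obtain i where "i < m" "y = shift_down \<sigma> i" by auto
    moreover from this have "\<sigma> (Suc i) \<in> {1..m}" unfolding permutes_in_image[OF assms] by simp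
    ultimately show "y \<in> {..<m}" using Suc_shift_down[OF assms, of i] by simp
  qed
  thus "bij_betw (shift_down \<sigma>) {..<m} {..<m}"
    using inj by (simp add: bij_betw_def endo_inj_surj)
  show "shift_down \<sigma> i = i" if "i \<notin> {..<m}" for i
    using that assms by (simp add: permutes_def shift_down_def)
qed

lemma shift_down_inject:
  assumes "\<sigma> permutes {1..m}" "\<rho> permutes {1..m}" "shift_down \<sigma> = shift_down \<rho>"
  shows "\<sigma> = \<rho>"
proof
  fix i
  show "\<sigma> i = \<rho> i"
  proof (cases i)
    case 0
    thus ?thesis using assms(1,2) by (simp add: permutes_def)
  next
    case (Suc k)
    thus ?thesis using Suc_shift_down[OF assms(1), of k] Suc_shift_down[OF assms(2), of k] assms(3)
      by simp
  qed
qed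

lemma shift_down_surj:
  assumes "\<tau> permutes {..<m}"
  obtains \<sigma> where "\<sigma> permutes {1..m}" "shift_down \<sigma> = \<tau>"
proof
  let ?\<sigma> = "\<lambda>i. if i = 0 then 0 else Suc (\<tau> (i - 1))"
  show "?\<sigma> permutes {1..m}"
  proof (rule bij_imp_permutes)
    have "inj_on ?\<sigma> {1..m}"
      by (rule inj_onI) (auto dest!: injD[OF permutes_inj[OF assms]])
    moreover have "?\<sigma> ` {1..m} \<subseteq> {1..m}"
    proof
      fix y assume "y \<in> ?\<sigma> ` {1..m}"
      then obtain i where "i \<in> {1..m}" "y = Suc (\<tau> (i - 1))" by auto
      moreover from this have "\<tau> (i - 1) \<in> {..<m}" unfolding permutes_in_image[OF assms] by auto
      ultimately show "y \<in> {1..m}" by simp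
    qed
    ultimately show "bij_betw ?\<sigma> {1..m} {1..m}"
      unfolding bij_betw_def using endo_inj_surj by blast
    show "?\<sigma> i = i" if "i \<notin> {1..m}" for i
      using that assms by (auto simp: permutes_def)
  qed
  show "shift_down ?\<sigma> = \<tau>" by (simp add: shift_down_def)
qed

lemma shift_down_id: "shift_down id = id"
  by (auto simp: shift_down_def)

text \<open>\<open>shift_down \<sigma>\<close> fixes every position from \<open>m\<close> on, so the
  untouched tail \<open>drop m K\<close> is covered by the same formula.\<close>

lemma permute_blocks_eq_permute_list:
  assumes "\<sigma> permutes {1..m}" "m \<le> length K"
  shows "permute_blocks m \<sigma> K = permute_list (shift_down \<sigma>) K"
proof (rule nth_equalityI)
  show "length (permute_blocks m \<sigma> K) = length (permute_list (shift_down \<sigma>) K)"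
    using assms(2) by (simp del: upt_Suc add: permute_blocks_def)
  fix i assume "i < length (permute_blocks m \<sigma> K)"
  hence "i < length K" using assms(2) by (simp del: upt_Suc add: permute_blocks_def)
  moreover have "\<sigma> (Suc i) = Suc i" if "\<not> i < m"
    using assms(1) that by (simp add: permutes_def)
  ultimately show "permute_blocks m \<sigma> K ! i = permute_list (shift_down \<sigma>) K ! i"
    using assms(2)
    by (cases "i < m") (simp_all del: upt_Suc add: permute_blocks_def permute_list_def shift_down_def nth_append)
qed

lemma permute_list_inv:
  assumes "\<tau> permutes {..<length xs}"
  shows "permute_list \<tau> (permute_list (inv \<tau>) xs) = xs"
  using permute_list_compose[OF assms, of "inv \<tau>"] by (simp add: permutes_inv_o(2)[OF assms])

text \<open>Sending each letter of \<open>w\<close> to the letter of \<open>w'\<close> at the same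
  position is well defined and injective because the equality patterns agree. The complements of the
  two letter sets in \<open>{1..N}\<close> have equal size, so this bijection extends to a
  permutation.\<close>

lemma extend_to_permutation:
  fixes w w' :: "nat list"
  assumes len: "length w = length w'"
    and pat: "\<And>i j. i < length w \<Longrightarrow> j < length w \<Longrightarrow> w ! i = w ! j \<longleftrightarrow> w' ! i = w' ! j"
    and pos: "0 \<notin> set w" "0 \<notin> set w'"
  obtains N s where "s permutes {1..N}" "map s w = w'"
proof -
  \<comment> \<open>\<open>insert 0\<close> keeps the set nonempty when both words are
    empty.\<close>
  define N where "N = Max (insert 0 (set w \<union> set w'))"
  have "x \<le> N" if "x \<in> set w \<union> set w'" for x using that by (simp add: N_def)
  hence sub: "set w \<subseteq> {1..N}" "set w' \<subseteq> {1..N}"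
    using pos by (auto simp: Suc_le_eq intro: gr0I)
  \<comment> \<open>The choice picks one position of each letter; by \<open>pat\<close> the result
    is the same at all its positions.\<close>
  have "\<forall>v \<in> set w. \<exists>u. \<exists>i < length w. w ! i = v \<and> w' ! i = u"
    by (auto simp: in_set_conv_nth)
  from bchoice[OF this] obtain f
    where f: "\<And>v. v \<in> set w \<Longrightarrow> \<exists>i < length w. w ! i = v \<and> w' ! i = f v" by blast
  have f_nth: "f (w ! i) = w' ! i" if i: "i < length w" for i
  proof -
    obtain k where "k < length w" "w ! k = w ! i" "w' ! k = f (w ! i)"
      using f[OF nth_mem[OF i]] by blast
    thus ?thesis using pat[of k i] i by simp
  qed
  have map: "map f w = w'" using len f_nth by (auto intro: nth_equalityI)
  have "inj_on f (set w)"
    by (rule inj_onI) (auto simp: in_set_conv_nth f_nth pat)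
  hence bf: "bij_betw f (set w) (set w')"
    unfolding bij_betw_def using map by (metis list.set_map)
  have "card (set w) = card (set w')" using bf by (rule bij_betw_same_card)
  hence "card ({1..N} - set w) = card ({1..N} - set w')"
    using sub by (simp add: card_Diff_subset)
  then obtain g where g: "bij_betw g ({1..N} - set w) ({1..N} - set w')"
    by (metis finite_same_card_bij finite_Diff finite_atLeastAtMost)
  define s where "s = (\<lambda>x. if x \<in> set w then f x else if x \<in> {1..N} then g x else x)"
  have "bij_betw s (set w) (set w')"
    using bf by (rule bij_betw_cong[THEN iffD1, rotated]) (simp add: s_def)
  moreover have "bij_betw s ({1..N} - set w) ({1..N} - set w')"
    using g by (rule bij_betw_cong[THEN iffD1, rotated]) (auto simp: s_def)
  ultimately have "bij_betw s (set w \<union> ({1..N} - set w)) (set w' \<union> ({1..N} - set w'))"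
    by (rule bij_betw_combine) auto
  hence "bij_betw s {1..N} {1..N}" using sub by (simp add: Un_absorb1)
  hence "s permutes {1..N}"
    by (rule bij_imp_permutes) (use sub in \<open>auto simp: s_def\<close>)
  moreover have "map s w = w'" using map by (auto simp: s_def)
  ultimately show ?thesis by (rule that)
qed

section \<open>Signs\<close>

text \<open>For distinct entries, the sign of the permutation that sorts \<open>a\<close>, hence the
  coefficient of the normally ordered monomial in the theta word of \<open>a\<close>. The product
  over pairs of positions lets permutations act by reindexing.\<close>

definition theta_sign :: "nat list \<Rightarrow> rat" where
  "theta_sign a = (\<Prod>j<length a. \<Prod>i<j. if a ! i < a ! j then 1 else -1)"

lemma theta_sign_Nil [simp]: "theta_sign [] = 1"
  by (simp add: theta_sign_def)

lemma theta_sign_Cons: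
  "theta_sign (x # a) = (\<Prod>j<length a. if x < a ! j then 1 else -1) * theta_sign a"
  by (simp add: theta_sign_def prod.lessThan_Suc_shift prod.distrib del: prod.lessThan_Suc)

lemma theta_sign_cases: "theta_sign a = 1 \<or> theta_sign a = -1"
proof -
  have "\<bar>theta_sign a\<bar> = 1"
    unfolding theta_sign_def abs_prod by (intro prod.neutral ballI) simp
  thus ?thesis by linarith
qed

lemma theta_sign_square [simp]: "theta_sign a * theta_sign a = 1"
  using theta_sign_cases[of a] by auto

lemma theta_sign_nonzero [simp]: "theta_sign a \<noteq> 0"
  using theta_sign_cases[of a] by auto

lemma merge_sign_singleton_set:
  assumes "distinct a" "x \<notin> set a"
  shows "merge_sign {x} (set a) = (\<Prod>j<length a. if x < a ! j then 1 else -1)"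
  using assms
proof (induction a)
  case (Cons y a)
  have "merge_sign {x} ({y} \<union> set a) = merge_sign {x} {y} * merge_sign {x} (set a)"
    using Cons.prems by (intro merge_sign_Un_right) auto
  thus ?case using Cons
    by (auto simp: merge_sign_single prod.lessThan_Suc_shift simp del: prod.lessThan_Suc)
qed simp

text \<open>Sharpens \<open>coeff_prod_theta\<close>, which leaves the sign undetermined: each new
  factor on the left contributes the sign of moving it past the smaller entries.\<close>

lemma coeff_prod_theta_eq:
  assumes "distinct a" "0 \<notin> set a"
  shows "coeff (prod_list (map theta a)) T c = (if T = set a \<and> c = [] then theta_sign a else 0)"
  using assms
proof (induction a arbitrary: T c)
  case (Cons x a)
  hence "coeff (prod_list (map theta a)) T c = (if T = set a \<and> c = [] then theta_sign a else 0)" for T c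
    by simp
  from coeff_mult_single[OF coeff_theta this, of x T c] Cons.prems show ?case
    by (auto simp: theta_sign_Cons merge_sign_singleton_set)
qed simp

lemma coeff_monom_eq:
  assumes "distinct a" "0 \<notin> set a" "0 \<notin> set b"
  shows "coeff (monom a b) T c = (if T = set a \<and> c = b then theta_sign a else 0)"
  unfolding monom_def
  by (simp add: coeff_mult_single[OF coeff_prod_theta_eq[OF assms(1,2)] coeff_prod_xvar] assms(3))

text \<open>The positions \<open>i < j\<close> of the permuted list carry the entries of
  \<open>a\<close> at \<open>\<tau> i\<close> and \<open>\<tau> j\<close>, and the sign of the pair
  changes exactly when \<open>\<tau>\<close> reverses its order. Every pair of positions is hit
  once, so only the inversions of \<open>\<tau>\<close> remain as a correction.\<close>

lemma theta_sign_permute_list: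
  assumes \<tau>: "\<tau> permutes {..<length a}" and dist: "distinct a"
  shows "theta_sign (permute_list \<tau> a) =
    (-1) ^ card {(i, j). i < j \<and> j < length a \<and> \<tau> j < \<tau> i} * theta_sign a"
proof -
  let ?m = "length a"
  \<comment> \<open>Pairs are stored with the larger position first. \<open>e\<close> is the sign of
    a pair in \<open>a\<close>, \<open>h\<close> the sorted image of a pair under
    \<open>\<tau>\<close>, and \<open>u\<close> corrects for the pairs that \<open>\<tau>\<close>
    inverts.\<close>
  define P where "P = (SIGMA j : {..<?m}. {..<j})"
  define e where "e = (\<lambda>(j, i). if a ! i < a ! j then 1 else -1 :: rat)"
  define h where "h = (\<lambda>(j, i). (max (\<tau> i) (\<tau> j), min (\<tau> i) (\<tau> j)))"
  define u where "u = (\<lambda>(j, i). if \<tau> j < \<tau> i then -1 else 1 :: rat)"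
  have finP: "finite P" by (simp add: P_def)
  have inj: "\<tau> i = \<tau> j \<longleftrightarrow> i = j" for i j using permutes_inj[OF \<tau>] by (auto dest: injD)
  have lt: "\<tau> i < ?m" if "i < ?m" for i using permutes_in_image[OF \<tau>, of i] that by simp
  have "inj_on h P"
    by (rule inj_onI) (auto simp: h_def P_def max_def min_def inj split: if_splits)
  moreover have "h ` P \<subseteq> P"
  proof
    fix z assume "z \<in> h ` P"
    then obtain j i where "i < j" "j < ?m" "z = h (j, i)" by (auto simp: P_def)
    moreover from this have "\<tau> i \<noteq> \<tau> j" "\<tau> i < ?m" "\<tau> j < ?m" by (auto simp: inj lt)
    ultimately show "z \<in> P" by (auto simp: h_def P_def)
  qed
  ultimately have h: "bij_betw h P P" unfolding bij_betw_def using endo_inj_surj[OF finP] by blast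
  have "theta_sign (permute_list \<tau> a) = (\<Prod>(j, i) \<in> P. if a ! \<tau> i < a ! \<tau> j then 1 else -1)"
    unfolding theta_sign_def P_def length_permute_list
    by (subst prod.Sigma[symmetric]) (auto intro!: prod.cong simp: permute_list_nth[OF \<tau>])
  also have "\<dots> = (\<Prod>z \<in> P. u z * e (h z))"
  proof (rule prod.cong)
    fix z assume "z \<in> P"
    then obtain j i where z: "z = (j, i)" "i < j" "j < ?m" by (auto simp: P_def)
    hence "\<tau> i \<noteq> \<tau> j" "a ! \<tau> i \<noteq> a ! \<tau> j"
      using dist lt by (auto simp: inj nth_eq_iff_index_eq)
    thus "(case z of (j, i) \<Rightarrow> if a ! \<tau> i < a ! \<tau> j then 1 else - 1) = u z * e (h z)"
      by (auto simp: z u_def e_def h_def)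
  qed simp
  also have "\<dots> = prod u P * (\<Prod>z \<in> P. e (h z))" by (rule prod.distrib)
  also have "(\<Prod>z \<in> P. e (h z)) = prod e P" by (rule prod.reindex_bij_betw[OF h])
  also have "prod e P = theta_sign a"
    unfolding theta_sign_def P_def e_def by (subst prod.Sigma[symmetric]) auto
  also have "prod u P = (-1) ^ card {(i, j). i < j \<and> j < ?m \<and> \<tau> j < \<tau> i}"
  proof -
    have "prod u P = (\<Prod>z \<in> {z \<in> P. \<tau> (fst z) < \<tau> (snd z)}. -1)"
      by (rule prod.mono_neutral_cong_right[OF finP]) (auto simp: u_def split: if_splits)
    also have "\<dots> = (-1) ^ card {z \<in> P. \<tau> (fst z) < \<tau> (snd z)}" by simp
    also have "card {z \<in> P. \<tau> (fst z) < \<tau> (snd z)} = card {(i, j). i < j \<and> j < ?m \<and> \<tau> j < \<tau> i}"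
      by (rule bij_betw_same_card[of prod.swap], rule bij_betw_byWitness[of _ prod.swap])
        (auto simp: P_def)
    finally show ?thesis .
  qed
  finally show ?thesis .
qed

text \<open>The two lists differ by a permutation of positions, which costs the same sign before and
  after applying \<open>s\<close>. Since signs square to 1, the product serves as the
  quotient.\<close>

lemma theta_sign_ratio:
  assumes dist: "distinct a" "distinct a'" and eq: "set a = set a'" and inj: "inj_on s (set a)"
  shows "theta_sign (map s a) * theta_sign (map s a') = theta_sign a * theta_sign a'"
proof -
  have "mset a = mset a'" using dist eq by (simp add: set_eq_iff_mset_eq_distinct)
  then obtain \<tau> where \<tau>: "\<tau> permutes {..<length a'}" "permute_list \<tau> a' = a"
    by (rule mset_eq_permutation)
  define k where "k = card {(i, j). i < j \<and> j < length a' \<and> \<tau> j < \<tau> i}"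
  have 1: "theta_sign a = (-1) ^ k * theta_sign a'"
    using theta_sign_permute_list[OF \<tau>(1) dist(2)] \<tau>(2) by (simp add: k_def)
  have "map s a = permute_list \<tau> (map s a')"
    using permute_list_map[OF \<tau>(1), of s] \<tau>(2) by simp
  moreover have "distinct (map s a')" using dist eq inj by (simp add: distinct_map)
  ultimately have 2: "theta_sign (map s a) = (-1) ^ k * theta_sign (map s a')"
    using theta_sign_permute_list[of \<tau> "map s a'"] \<tau>(1) by (simp add: k_def)
  show ?thesis by (simp add: 1 2 mult.assoc)
qed

lemma inversions_shift_down:
  assumes "\<sigma> permutes {1..m}"
  shows "inversions m \<sigma> = card {(i, j). i < j \<and> j < m \<and> shift_down \<sigma> j < shift_down \<sigma> i}"
proof -
  have less: "shift_down \<sigma> j < shift_down \<sigma> i \<longleftrightarrow> \<sigma> (Suc j) < \<sigma> (Suc i)" for i j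
    using Suc_shift_down[OF assms, of i] Suc_shift_down[OF assms, of j] by linarith
  have "{(i, j). 1 \<le> i \<and> i < j \<and> j \<le> m \<and> \<sigma> i > \<sigma> j} =
      map_prod Suc Suc ` {(i, j). i < j \<and> j < m \<and> shift_down \<sigma> j < shift_down \<sigma> i}"
  proof (intro equalityI subsetI)
    fix z assume "z \<in> {(i, j). 1 \<le> i \<and> i < j \<and> j \<le> m \<and> \<sigma> i > \<sigma> j}"
    then obtain i j where z: "z = (i, j)" "1 \<le> i" "i < j" "j \<le> m" "\<sigma> i > \<sigma> j" by auto
    then obtain i' j' where "i = Suc i'" "j = Suc j'" by (cases i; cases j) auto
    thus "z \<in> map_prod Suc Suc ` {(i, j). i < j \<and> j < m \<and> shift_down \<sigma> j < shift_down \<sigma> i}"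
      using z by (auto simp: less)
  qed (auto simp: less)
  thus ?thesis unfolding inversions_def
    by (simp add: card_image inj_on_subset[OF prod.inj_map[OF inj_Suc inj_Suc]])
qed

section \<open>Action of permutations of the variables\<close>

lemma coeff_zero_index: "0 \<in> T \<Longrightarrow> coeff f T c = 0" "0 \<in> set c \<Longrightarrow> coeff f T c = 0"
  using coeff[of f] by (auto simp: is_series_def)

text \<open>\<open>coeff f (set a) b * theta_sign a\<close> is the coefficient of \<open>f\<close>
  at the word \<open>(a, b)\<close> with \<open>a\<close> left unsorted. In this form renaming acts
  letter by letter without an extra sign.\<close>

lemma coeff_rename_sign:
  assumes s: "s permutes {1..N}" and a: "distinct a" "0 \<notin> set a" and b: "0 \<notin> set b"
  shows "coeff (rename s f) (s ` set a) (map s b) * theta_sign (map s a) =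
    coeff f (set a) b * theta_sign a"
proof -
  \<comment> \<open>\<open>rename\<close> works with the sorted listing, whose sign is 1;
    \<open>theta_sign_ratio\<close> passes from it to \<open>a\<close>.\<close>
  let ?l = "sorted_list_of_set (set a)"
  have inj: "inj s" using s by (rule permutes_inj)
  have s0: "0 \<notin> s ` set a" "0 \<notin> s ` set b"
  proof -
    have "s 0 = 0" using permutes_not_in[OF s, of 0] by simp
    hence "0 \<notin> s ` A" if "0 \<notin> A" for A using that inj by (metis imageE injD)
    thus "0 \<notin> s ` set a" "0 \<notin> s ` set b" using a b by blast+
  qed
  have l: "distinct (map s ?l)" "0 \<notin> set (map s ?l)" "0 \<notin> set (map s b)"
    using s0 by (simp_all add: distinct_map inj_on_subset[OF inj])
  have "coeff (rename s f) (s ` set a) (map s b) = coeff f (set a) b * theta_sign (map s ?l)"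
    using inj by (simp add: coeff_rename[OF s] image_image o_def coeff_monom_eq[OF l])
  moreover have "theta_sign (map s ?l) * theta_sign (map s a) = theta_sign ?l * theta_sign a"
    by (rule theta_sign_ratio) (simp_all add: a inj_on_subset[OF inj])
  moreover have "theta_sign ?l = 1"
    unfolding theta_sign_def
    by (intro prod.neutral ballI)
      (use sorted_wrt_nth_less[OF strict_sorted_list_of_set, of _ _ "set a"] in auto)
  ultimately show ?thesis by (simp add: mult.assoc)
qed

section \<open>Blocks and words\<close>

text \<open>Both orderings in the definition of a set superpartition, that of the fermionic blocks and
  that of the nonfermionic ones, are orderings by this key.\<close>

definition block_key :: "nat set \<Rightarrow> nat" where
  "block_key B = min0 (B - {0})"

text \<open>Positions count from 1, as elements of blocks do, so that 0 stays free as the mark of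
  fermionic blocks.\<close>

definition level :: "'a list \<Rightarrow> 'a \<Rightarrow> nat set" where
  "level b v = {j. 1 \<le> j \<and> j \<le> length b \<and> b ! (j - 1) = v}"

lemma zero_not_in_level [simp]: "0 \<notin> level b v"
  by (simp add: level_def)

lemma finite_level [simp]: "finite (level b v)"
  by (rule finite_subset[of _ "{..length b}"]) (auto simp: level_def)

lemma level_empty_iff: "level b v = {} \<longleftrightarrow> v \<notin> set b"
proof -
  have "\<exists>j. j \<in> level b v" if v: "v \<in> set b"
  proof -
    obtain i where "i < length b" "b ! i = v" using v by (auto simp: in_set_conv_nth)
    thus ?thesis by (intro exI[of _ "Suc i"]) (simp add: level_def)
  qed
  thus ?thesis by (auto simp: level_def)
qed

lemma block_key_insert_0 [simp]: "block_key (insert 0 B) = block_key B"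
  by (simp add: block_key_def)

lemma block_key_nonfermionic: "0 \<notin> B \<Longrightarrow> B \<noteq> {} \<Longrightarrow> block_key B = Min B"
  by (simp add: block_key_def min0_def)

lemma block_key_level_in: "v \<in> set b \<Longrightarrow> block_key (level b v) \<in> level b v"
  using Min_in[of "level b v"] by (simp add: block_key_nonfermionic level_empty_iff)

text \<open>A letter of \<open>b\<close> has a positive key lying in its own level set, and distinct
  level sets are disjoint; a letter outside \<open>b\<close> has key 0. So only letters outside
  \<open>b\<close> could collide, and \<open>V\<close> has at most one. For \<open>V = set a\<close>
  this bound says that the word is not null-symmetric.\<close>

lemma inj_on_block_key_level:
  assumes "card (V - set b) \<le> 1" "finite V"
  shows "inj_on (\<lambda>v. block_key (level b v)) V"
proof (rule inj_onI)
  fix v w assume vw: "v \<in> V" "w \<in> V" "block_key (level b v) = block_key (level b w)"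
  have key0: "block_key (level b u) = 0 \<longleftrightarrow> u \<notin> set b" for u
  proof
    assume "block_key (level b u) = 0"
    thus "u \<notin> set b" using block_key_level_in[of u b] by (metis zero_not_in_level)
  next
    assume "u \<notin> set b"
    hence "level b u = {}" by (simp add: level_empty_iff)
    thus "block_key (level b u) = 0" by (simp add: block_key_def min0_def)
  qed
  show "v = w"
  proof (cases "v \<in> set b")
    case True
    moreover from this have "w \<in> set b" using vw key0 by metis
    ultimately have "block_key (level b v) \<in> level b v \<inter> level b w"
      using vw(3) block_key_level_in[of v b] block_key_level_in[of w b] by simp
    thus ?thesis by (auto simp: level_def)
  next
    case False
    hence "v \<in> V - set b" "w \<in> V - set b" using vw key0 by (metis DiffI)+
    thus ?thesis using assms by (metis card_le_Suc0_iff_eq One_nat_def finite_Diff)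
  qed
qed

section \<open>Supercompositions and superpartitions in terms of block keys\<close>

lemma ball_atLeast1_conv: "(\<forall>i \<in> {1..k}. Q i) \<longleftrightarrow> (\<forall>i < k. Q (Suc i))"
proof -
  have eq: "{1..k} = Suc ` {..<k}" by (simp add: image_Suc_lessThan)
  show ?thesis unfolding eq by auto
qed

text \<open>Nonfermionic blocks are nonempty and omit 0, so \<open>Min\<close> agrees with
  \<open>block_key\<close> on them. Positions now start at 0.\<close>

lemma supercomps_iff:
  "K \<in> supercomps n m \<longleftrightarrow>
     m \<le> length K \<and> (\<forall>B \<in> set K. B \<noteq> {} \<and> B \<subseteq> {0..n}) \<and> (\<Union>B \<in> set K. B - {0}) = {1..n} \<and>
     (\<forall>i < length K. \<forall>j < length K. i \<noteq> j \<longrightarrow> K ! i \<inter> K ! j \<subseteq> {0}) \<and>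
     (\<forall>i < length K. 0 \<in> K ! i \<longleftrightarrow> i < m) \<and>
     sorted_wrt (\<lambda>A B. block_key A < block_key B) (drop m K)"
proof -
  have "(\<forall>i j. m < i \<and> i < j \<and> j \<le> length K \<longrightarrow> Min (K ! (i - 1)) < Min (K ! (j - 1))) \<longleftrightarrow>
      sorted_wrt (\<lambda>A B. block_key A < block_key B) (drop m K)" (is "?L \<longleftrightarrow> ?R")
    if len: "m \<le> length K" and ne: "\<forall>B \<in> set K. B \<noteq> {} \<and> B \<subseteq> {0..n}"
      and zero: "\<forall>i < length K. 0 \<in> K ! i \<longleftrightarrow> i < m"
  proof -
    have key: "block_key (K ! i) = Min (K ! i)" if "m \<le> i" "i < length K" for i
      using that ne zero by (intro block_key_nonfermionic) auto
    show ?thesis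
    proof
      assume L: ?L
      show ?R unfolding sorted_wrt_iff_nth_less
      proof (intro allI impI)
        fix i j assume "i < j" "j < length (drop m K)"
        thus "block_key (drop m K ! i) < block_key (drop m K ! j)"
          using L[rule_format, of "Suc (m + i)" "Suc (m + j)"] len by (simp add: key)
      qed
    next
      assume R: ?R
      show ?L
      proof (intro allI impI)
        fix i j assume ij: "m < i \<and> i < j \<and> j \<le> length K"
        hence "i - 1 - m < j - 1 - m" "j - 1 - m < length K - m" by linarith+
        moreover have "block_key (K ! (i - 1)) = Min (K ! (i - 1))" "block_key (K ! (j - 1)) = Min (K ! (j - 1))"
          by (rule key; use ij in linarith)+
        ultimately show "Min (K ! (i - 1)) < Min (K ! (j - 1))"
          using R[unfolded sorted_wrt_iff_nth_less, rule_format, of "i - 1 - m" "j - 1 - m"] ij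
          by simp
      qed
    qed
  qed
  thus ?thesis
    unfolding supercomps_def mem_Collect_eq ball_atLeast1_conv by (auto simp: Suc_le_eq)
qed

text \<open>Subtracting one block from another of the same kind removes at most 0, so for such pairs
  the condition compares block keys. For nonfermionic pairs a supercomposition already has this
  order, and for mixed pairs the condition is automatic. Only the order of the fermionic blocks
  remains.\<close>

lemma superparts_iff:
  "K \<in> superparts n m \<longleftrightarrow>
     K \<in> supercomps n m \<and> sorted_wrt (\<lambda>A B. block_key A < block_key B) (take m K)"
proof -
  let ?C = "\<lambda>i j. K ! i \<noteq> K ! j \<and> min0 (K ! i - K ! j) < min0 (K ! j - K ! i)"
  have idx: "(\<forall>i j. 1 \<le> i \<and> i < j \<and> j \<le> length K \<longrightarrow> ?C (i - 1) (j - 1)) \<longleftrightarrow>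
      (\<forall>i j. i < j \<and> j < length K \<longrightarrow> ?C i j)" (is "?L \<longleftrightarrow> ?R")
  proof
    assume L: ?L
    show ?R
    proof (intro allI impI)
      fix i j assume "i < j \<and> j < length K"
      thus "?C i j" using L[rule_format, of "Suc i" "Suc j"] by simp
    qed
  next
    assume R: ?R
    show ?L
    proof (intro allI impI)
      fix i j assume "1 \<le> i \<and> i < j \<and> j \<le> length K"
      hence "i - 1 < j - 1 \<and> j - 1 < length K" by linarith
      thus "?C (i - 1) (j - 1)" using R by blast
    qed
  qed
  have "(\<forall>i j. i < j \<and> j < length K \<longrightarrow> ?C i j) \<longleftrightarrow>
      sorted_wrt (\<lambda>A B. block_key A < block_key B) (take m K)" (is "?L \<longleftrightarrow> ?R")
    if K: "K \<in> supercomps n m"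
  proof -
    have len: "m \<le> length K"
      and block: "\<And>B. B \<in> set K \<Longrightarrow> B \<noteq> {} \<and> B \<subseteq> {0..n}"
      and disj: "\<And>i j. i < length K \<Longrightarrow> j < length K \<Longrightarrow> i \<noteq> j \<Longrightarrow> K ! i \<inter> K ! j \<subseteq> {0}"
      and zero: "\<And>i. i < length K \<Longrightarrow> 0 \<in> K ! i \<longleftrightarrow> i < m"
      and sorted: "sorted_wrt (\<lambda>A B. block_key A < block_key B) (drop m K)"
      using K unfolding supercomps_iff by blast+
    have ne: "K ! i \<noteq> {} \<and> finite (K ! i)" if "i < length K" for i
      using block[OF nth_mem[OF that]] finite_subset by blast
    \<comment> \<open>Either 0 lies in \<open>K ! j\<close> and is removed, or it is not in
      \<open>K ! i\<close> to begin with.\<close>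
    have diff: "K ! i - K ! j = K ! i - {0}" if "i < length K" "j < length K" "i \<noteq> j" "j < m \<or> m \<le> i" for i j
      using disj[OF that(1-3)] zero[of i] zero[of j] that(1,2,4) by auto
    show ?thesis
    proof
      assume L: ?L
      show ?R unfolding sorted_wrt_iff_nth_less
      proof (intro allI impI)
        fix i j assume ij: "i < j" "j < length (take m K)"
        have "K ! i - K ! j = K ! i - {0}" "K ! j - K ! i = K ! j - {0}"
          by (rule diff; use ij in auto)+
        thus "block_key (take m K ! i) < block_key (take m K ! j)"
          using L[rule_format, of i j] ij by (simp add: block_key_def)
      qed
    next
      assume R: ?R
      show ?L
      proof (intro allI impI)
        fix i j assume "i < j \<and> j < length K"
        hence ij: "i < j" "j < length K" "i < length K" by auto
        consider "j < m" | "i < m" "m \<le> j" | "m \<le> i" by linarith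
        thus "?C i j"
        proof cases
          case 1
          hence "block_key (K ! i) < block_key (K ! j)"
            using R[unfolded sorted_wrt_iff_nth_less, rule_format, of i j] ij by simp
          moreover have "K ! i - K ! j = K ! i - {0}" "K ! j - K ! i = K ! j - {0}"
            by (rule diff; use 1 ij in auto)+
          ultimately show ?thesis by (auto simp: block_key_def)
        next
          case 2
          \<comment> \<open>The fermionic block keeps its 0, so its difference has minimum 0; the
            nonfermionic block keeps all its elements, which are positive.\<close>
          have "0 \<in> K ! i - K ! j" "finite (K ! i - K ! j)" using 2 ij zero ne by auto
          hence "min0 (K ! i - K ! j) = 0" using Min_le[of "K ! i - K ! j" 0] by (auto simp: min0_def)
          moreover have "K ! j - K ! i = K ! j" "0 \<notin> K ! j" "K ! j \<noteq> {}" "finite (K ! j)"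
            using disj[of i j] 2 ij zero ne by auto
          moreover from this have "Min (K ! j) \<in> K ! j" by simp
          ultimately show ?thesis using 2 ij zero by (auto simp: min0_def intro!: gr0I)
        next
          case 3
          hence "block_key (K ! i) < block_key (K ! j)"
            using sorted[unfolded sorted_wrt_iff_nth_less, rule_format, of "i - m" "j - m"] ij by simp
          moreover have "K ! i - K ! j = K ! i - {0}" "K ! j - K ! i = K ! j - {0}"
            by (rule diff; use 3 ij in auto)+
          ultimately show ?thesis by (auto simp: block_key_def)
        qed
      qed
    qed
  qed
  thus ?thesis unfolding superparts_def mem_Collect_eq idx by blast
qed

section \<open>Blocks determined by a word\<close>

lemma words_iff:
  "(a, b) \<in> words n m K \<longleftrightarrow>
     length a = m \<and> length b = n \<and> 0 \<notin> set a \<and> 0 \<notin> set b \<and>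
     (\<forall>i < m. \<forall>j \<in> {1..n}. a ! i = b ! (j - 1) \<longleftrightarrow> j \<in> K ! i) \<and>
     (\<forall>j \<in> {1..n}. \<forall>k \<in> {1..n}. b ! (j - 1) = b ! (k - 1) \<longleftrightarrow> (\<exists>B \<in> set K. j \<in> B \<and> k \<in> B))"
proof -
  have "(\<forall>i \<in> {1..m}. \<forall>j \<in> {1..n}. a ! (i - 1) = b ! (j - 1) \<longleftrightarrow> j \<in> K ! (i - 1) - {0}) \<longleftrightarrow>
      (\<forall>i < m. \<forall>j \<in> {1..n}. a ! i = b ! (j - 1) \<longleftrightarrow> j \<in> K ! i)"
    unfolding ball_atLeast1_conv[of m] by simp
  thus ?thesis by (simp only: words_def mem_Collect_eq case_prod_conv)
qed

text \<open>Equalities between letters say which positions share a block. The fermionic blocks are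
  read off in the order of \<open>a\<close>, hence as a list; the word records no order of the
  others, so they are recovered only as a set.\<close>

lemma words_blocks:
  assumes K: "K \<in> supercomps n m" and w: "(a, b) \<in> words n m K"
  shows "take m K = map (\<lambda>v. insert 0 (level b v)) a"
    and "set (drop m K) = level b ` (set b - set a)"
proof -
  have len: "m \<le> length K"
    and ne: "\<And>B. B \<in> set K \<Longrightarrow> B \<noteq> {} \<and> B \<subseteq> {0..n}"
    and union: "(\<Union>B \<in> set K. B - {0}) = {1..n}"
    and disj: "\<And>i j. i < length K \<Longrightarrow> j < length K \<Longrightarrow> i \<noteq> j \<Longrightarrow> K ! i \<inter> K ! j \<subseteq> {0}"
    and zero: "\<And>i. i < length K \<Longrightarrow> 0 \<in> K ! i \<longleftrightarrow> i < m"
    using K unfolding supercomps_iff by blast+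
  have lab: "length a = m" "length b = n"
    and ab: "\<And>i j. i < m \<Longrightarrow> j \<in> {1..n} \<Longrightarrow> a ! i = b ! (j - 1) \<longleftrightarrow> j \<in> K ! i"
    and bb: "\<And>j k. j \<in> {1..n} \<Longrightarrow> k \<in> {1..n} \<Longrightarrow>
      b ! (j - 1) = b ! (k - 1) \<longleftrightarrow> (\<exists>B \<in> set K. j \<in> B \<and> k \<in> B)"
    using w unfolding words_iff by blast+
  show "take m K = map (\<lambda>v. insert 0 (level b v)) a"
  proof (rule nth_equalityI)
    fix i assume "i < length (take m K)"
    hence i: "i < m" "i < length K" by simp_all
    hence Ki: "0 \<in> K ! i" "K ! i \<subseteq> {0..n}" using ne[of "K ! i"] by (auto simp: zero)
    have "K ! i = insert 0 (level b (a ! i))"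
    proof (intro equalityI subsetI)
      fix j assume j: "j \<in> K ! i"
      show "j \<in> insert 0 (level b (a ! i))"
      proof (cases "j = 0")
        case False
        hence "j \<in> {1..n}" using j Ki by auto
        thus ?thesis using ab[of i j] i j lab by (simp add: level_def)
      qed simp
    next
      fix j assume "j \<in> insert 0 (level b (a ! i))"
      thus "j \<in> K ! i" using ab[of i j] i Ki lab by (auto simp: level_def)
    qed
    thus "take m K ! i = map (\<lambda>v. insert 0 (level b v)) a ! i" using i lab by simp
  qed (use len lab in simp)
  \<comment> \<open>A nonfermionic block is the full level set of one letter. That letter is not in
    \<open>a\<close>, as otherwise \<open>j\<close> would also lie in a fermionic block, against
    disjointness.\<close>
  have block: "K ! p = level b (b ! (j - 1)) \<and> b ! (j - 1) \<in> set b - set a"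
    if p: "m \<le> p" "p < length K" and j: "j \<in> K ! p" for p j
  proof -
    have Kp: "K ! p \<subseteq> {1..n}"
    proof
      fix k assume k: "k \<in> K ! p"
      hence "k \<noteq> 0" using zero[OF p(2)] p(1) by (metis leD)
      thus "k \<in> {1..n}" using k ne[of "K ! p"] p by auto
    qed
    hence j1: "j \<in> {1..n}" using j by blast
    have "K ! p = level b (b ! (j - 1))"
    proof (intro equalityI subsetI)
      fix k assume k: "k \<in> K ! p"
      hence "k \<in> {1..n}" using Kp by blast
      moreover from this have "b ! (k - 1) = b ! (j - 1)" using bb[of k j] j1 j k nth_mem[OF p(2)] by blast
      ultimately show "k \<in> level b (b ! (j - 1))" using lab by (simp add: level_def)
    next
      fix k assume "k \<in> level b (b ! (j - 1))"
      hence k: "k \<in> {1..n}" "b ! (j - 1) = b ! (k - 1)" using lab by (auto simp: level_def)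
      then obtain B where "B \<in> set K" "j \<in> B" "k \<in> B" using bb j1 by blast
      moreover from this obtain q where "q < length K" "B = K ! q" by (auto simp: in_set_conv_nth)
      ultimately show "k \<in> K ! p" using disj[of p q] p j j1 by (cases "p = q") auto
    qed
    moreover have "b ! (j - 1) \<in> set b" using j1 lab by auto
    moreover have "b ! (j - 1) \<notin> set a"
    proof
      assume "b ! (j - 1) \<in> set a"
      then obtain i where i: "i < m" "a ! i = b ! (j - 1)" using lab by (auto simp: in_set_conv_nth)
      hence "j \<in> K ! i" using ab j1 by blast
      thus False using disj[of i p] i p j j1 by auto
    qed
    ultimately show ?thesis by blast
  qed
  show "set (drop m K) = level b ` (set b - set a)"
  proof (intro equalityI subsetI)
    fix B assume "B \<in> set (drop m K)"
    then obtain i where i: "i < length K - m" "B = K ! (m + i)" by (auto simp: in_set_conv_nth)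
    moreover from this have "B \<in> set K" by auto
    then obtain j where "j \<in> B" using ne by blast
    ultimately show "B \<in> level b ` (set b - set a)" using block[of "m + i" j] by auto
  next
    fix B assume "B \<in> level b ` (set b - set a)"
    then obtain v where v: "v \<in> set b" "v \<notin> set a" "B = level b v" by blast
    then obtain j where j: "j \<in> {1..n}" "b ! (j - 1) = v"
      using lab by (auto simp: in_set_conv_nth intro!: that[of "Suc _"])
    have "j \<in> (\<Union>B \<in> set K. B - {0})" unfolding union by (rule j(1))
    then obtain p where p: "p < length K" "j \<in> K ! p"
      by (auto simp: in_set_conv_nth)
    have "m \<le> p"
    proof (rule ccontr)
      assume "\<not> m \<le> p"
      hence "a ! p = v" "p < m" using ab[of p j] j p by auto
      thus False using v lab by auto
    qed
    moreover from this have "B = K ! p" using block[of p j] p j v by simp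
    ultimately have "B = drop m K ! (p - m)" "p - m < length (drop m K)" using p by simp_all
    thus "B \<in> set (drop m K)" by (simp only: nth_mem)
  qed
qed

lemma superparts_eqI:
  assumes I: "I \<in> superparts n m" and J: "J \<in> superparts n m"
    and "set (take m I) = set (take m J)" "set (drop m I) = set (drop m J)"
  shows "I = J"
proof -
  have "take m I = take m J" "drop m I = drop m J"
    using assms by (auto simp: superparts_iff supercomps_iff intro: sorted_wrt_key_unique)
  thus ?thesis by (metis append_take_drop_id)
qed

lemma finite_superparts: "finite (superparts n m)"
proof (rule finite_subset)
  show "superparts n m \<subseteq> {K. set K \<subseteq> Pow {0..n} \<and> distinct K}"
  proof
    fix K assume K: "K \<in> superparts n m"
    have "K ! i \<noteq> K ! j" if "i < j" "j < length K" for i j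
    proof -
      have "\<forall>i j. 1 \<le> i \<and> i < j \<and> j \<le> length K \<longrightarrow> K ! (i - 1) \<noteq> K ! (j - 1)"
        using K unfolding superparts_def by blast
      from this[rule_format, of "Suc i" "Suc j"] show ?thesis using that by simp
    qed
    hence "distinct K" unfolding distinct_conv_nth by (metis linorder_neqE_nat)
    thus "K \<in> {K. set K \<subseteq> Pow {0..n} \<and> distinct K}"
      using K by (auto simp: superparts_iff supercomps_iff)
  qed
qed (simp add: finite_subset_distinct)

text \<open>The set of entries of \<open>a\<close> fixes the set of fermionic blocks, and sorting by
  key does the rest. The fermionic blocks of a superpartition are distinct, so each letter of
  \<open>a\<close> is recovered from its block.\<close>

lemma words_superparts_unique:
  assumes I: "I \<in> superparts n m" and J: "J \<in> superparts n m"
    and w: "(a, b) \<in> words n m I" "(a', b) \<in> words n m J" and eq: "set a = set a'"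
  shows "I = J" "a = a'" "distinct a"
proof -
  have I': "I \<in> supercomps n m" and J': "J \<in> supercomps n m"
    using I J by (simp_all add: superparts_iff)
  show IJ: "I = J"
    using I J by (rule superparts_eqI) (simp_all add: words_blocks[OF I' w(1)] words_blocks[OF J' w(2)] eq)
  have "distinct (take m I)"
    using I by (auto simp: superparts_iff intro: sorted_wrt_key_distinct)
  hence dist: "distinct (map (\<lambda>v. insert 0 (level b v)) a)"
    by (simp add: words_blocks(1)[OF I' w(1)])
  thus "distinct a" by (simp add: distinct_map)
  have "map (\<lambda>v. insert 0 (level b v)) a = map (\<lambda>v. insert 0 (level b v)) a'"
    using words_blocks(1)[OF I' w(1)] words_blocks(1)[OF J' w(2)] IJ by simp
  thus "a = a'" by (rule map_inj_on) (use dist eq in \<open>simp add: distinct_map\<close>)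
qed

text \<open>The letters of \<open>a\<close>, and those of \<open>b\<close> outside \<open>a\<close>,
  are sorted by the keys of their level sets, which then give the blocks. A letter of
  \<open>a\<close> missing from \<open>b\<close> gives the block \<open>{0}\<close>.\<close>

lemma ex_superpart:
  assumes len: "length a = m" "length b = n" and pos: "0 \<notin> set a" "0 \<notin> set b"
    and dist: "distinct a" and null: "\<not> null_symmetric a b"
  obtains a' I where "set a' = set a" "distinct a'" "I \<in> superparts n m" "(a', b) \<in> words n m I"
proof -
  have "inj_on (\<lambda>v. block_key (level b v)) (set a)"
    using null by (intro inj_on_block_key_level) (simp_all add: null_symmetric_def)
  then obtain a' where a': "sorted_wrt (\<lambda>v w. block_key (level b v) < block_key (level b w)) a'"
      "set a' = set a"
    by (rule ex_sorted_wrt_key[rotated]) simp_all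
  \<comment> \<open>For the remaining letters the bound in \<open>inj_on_block_key_level\<close> is
    trivial, since all of them occur in \<open>b\<close>.\<close>
  have empty: "set b - set a - set b = {}" by auto
  have "inj_on (\<lambda>v. block_key (level b v)) (set b - set a)"
    by (rule inj_on_block_key_level) (simp_all only: empty card.empty zero_le finite_Diff finite_set)
  then obtain c where c: "sorted_wrt (\<lambda>v w. block_key (level b v) < block_key (level b w)) c"
      "set c = set b - set a"
    by (rule ex_sorted_wrt_key[rotated]) simp_all
  have dist': "distinct a'" "distinct c" using a' c by (auto intro: sorted_wrt_key_distinct)
  have len': "length a' = m" using dist dist'(1) a'(2) len(1) by (metis distinct_card)
  let ?I = "map (\<lambda>v. insert 0 (level b v)) a' @ map (level b) c"
  have dist_ac: "distinct (a' @ c)" using dist' a' c by auto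
  \<comment> \<open>Removing 0 treats both kinds of block alike and reduces disjointness to
    distinctness of \<open>a' @ c\<close>.\<close>
  have nth: "?I ! i - {0} = level b ((a' @ c) ! i)" if "i < length ?I" for i
    using that len' by (auto simp: nth_append)
  have level_sub: "level b v \<subseteq> {1..n}" for v using len by (auto simp: level_def)
  have "?I \<in> supercomps n m" unfolding supercomps_iff
  proof (intro conjI)
    show "\<forall>B \<in> set ?I. B \<noteq> {} \<and> B \<subseteq> {0..n}"
    proof
      fix B assume "B \<in> set ?I"
      then consider v where "B = insert 0 (level b v)" | v where "v \<in> set b" "B = level b v"
        using c by auto
      thus "B \<noteq> {} \<and> B \<subseteq> {0..n}"
      proof cases
        case (1 v)
        thus ?thesis using level_sub[of v] by auto
      next
        case (2 v)
        thus ?thesis using level_sub[of v] level_empty_iff[of b v] by auto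
      qed
    qed
    show "(\<Union>B \<in> set ?I. B - {0}) = {1..n}"
    proof (intro equalityI subsetI)
      fix j assume "j \<in> {1..n}"
      hence "j \<in> level b (b ! (j - 1))" "b ! (j - 1) \<in> set b" using len by (auto simp: level_def)
      moreover from this have "b ! (j - 1) \<in> set a' \<union> set c" using a' c by auto
      ultimately show "j \<in> (\<Union>B \<in> set ?I. B - {0})" by (auto simp: level_def)
    qed (use len in \<open>auto simp: level_def split: if_splits\<close>)
    show "\<forall>i < length ?I. \<forall>j < length ?I. i \<noteq> j \<longrightarrow> ?I ! i \<inter> ?I ! j \<subseteq> {0}"
    proof (intro allI impI subsetI)
      fix i j k assume ij: "i < length ?I" "j < length ?I" "i \<noteq> j" and k: "k \<in> ?I ! i \<inter> ?I ! j"
      show "k \<in> {0}"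
      proof (rule ccontr)
        assume "k \<notin> {0}"
        hence "k \<in> level b ((a' @ c) ! i) \<inter> level b ((a' @ c) ! j)"
          using k nth[OF ij(1)] nth[OF ij(2)] by blast
        hence "(a' @ c) ! i = (a' @ c) ! j" by (auto simp: level_def)
        thus False using ij dist_ac by (simp add: nth_eq_iff_index_eq)
      qed
    qed
    show "\<forall>i < length ?I. 0 \<in> ?I ! i \<longleftrightarrow> i < m" using len' by (auto simp: nth_append)
  qed (use c len' in \<open>simp_all add: sorted_wrt_map\<close>)
  hence "?I \<in> superparts n m" using a' len' by (simp add: superparts_iff sorted_wrt_map)
  moreover have "(a', b) \<in> words n m ?I" unfolding words_iff
  proof (intro conjI)
    show "\<forall>i < m. \<forall>j \<in> {1..n}. a' ! i = b ! (j - 1) \<longleftrightarrow> j \<in> ?I ! i"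
      using len len' by (auto simp: nth_append level_def)
    show "\<forall>j \<in> {1..n}. \<forall>k \<in> {1..n}. b ! (j - 1) = b ! (k - 1) \<longleftrightarrow> (\<exists>B \<in> set ?I. j \<in> B \<and> k \<in> B)"
    proof (intro ballI iffI)
      fix j k assume jk: "j \<in> {1..n}" "k \<in> {1..n}" "b ! (j - 1) = b ! (k - 1)"
      have "b ! (j - 1) \<in> set b" using jk len by auto
      hence "b ! (j - 1) \<in> set a' \<union> set c" using a' c by auto
      moreover have "j \<in> level b (b ! (j - 1))" "k \<in> level b (b ! (j - 1))"
        using jk len by (auto simp: level_def)
      ultimately show "\<exists>B \<in> set ?I. j \<in> B \<and> k \<in> B" by auto
    next
      fix j k assume jk: "j \<in> {1..n}" "k \<in> {1..n}" "\<exists>B \<in> set ?I. j \<in> B \<and> k \<in> B"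
      thus "b ! (j - 1) = b ! (k - 1)" by (auto simp: level_def)
    qed
  qed (use len len' pos a' in auto)
  ultimately show ?thesis using that a' dist' by blast
qed

section \<open>Block permutations acting on words\<close>

lemma words_permute_list_subset:
  assumes \<tau>: "\<tau> permutes {..<m}" and len: "m \<le> length K" and w: "(a, b) \<in> words n m K"
  shows "(permute_list \<tau> a, b) \<in> words n m (permute_list \<tau> K)"
proof -
  have la: "length a = m" using w by (simp add: words_iff)
  have \<tau>K: "\<tau> permutes {..<length K}" by (rule permutes_subset[OF \<tau>]) (use len in auto)
  have lt: "\<tau> i < m" if "i < m" for i using permutes_in_image[OF \<tau>, of i] that by simp
  show ?thesis
    using w \<tau> len lt unfolding words_iff
    by (simp add: la permute_list_nth[OF \<tau>K] permute_list_nth[of \<tau> a] set_permute_list[OF \<tau>K])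
qed

text \<open>Permuting the fermionic blocks permutes the entries of \<open>a\<close> in the same way
  and leaves \<open>b\<close> alone. The converse is the same implication for the inverse
  permutation.\<close>

lemma words_permute_list:
  assumes \<tau>: "\<tau> permutes {..<m}" and len: "m \<le> length K"
  shows "(a, b) \<in> words n m (permute_list \<tau> K) \<longleftrightarrow>
    (\<exists>a'. a = permute_list \<tau> a' \<and> (a', b) \<in> words n m K)"
proof
  assume w: "(a, b) \<in> words n m (permute_list \<tau> K)"
  have la: "length a = m" using w by (simp add: words_iff)
  have \<tau>K: "inv \<tau> permutes {..<length K}"
    using permutes_inv[OF \<tau>] by (rule permutes_subset) (use len in auto)
  have "permute_list (inv \<tau>) (permute_list \<tau> K) = K"
    using permute_list_inv[OF \<tau>K] by (simp add: inv_inv_eq[OF permutes_bij[OF \<tau>]])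
  hence "(permute_list (inv \<tau>) a, b) \<in> words n m K"
    using words_permute_list_subset[OF permutes_inv[OF \<tau>] _ w] len by simp
  moreover have "a = permute_list \<tau> (permute_list (inv \<tau>) a)"
    using permute_list_inv[of \<tau> a] \<tau> la by simp
  ultimately show "\<exists>a'. a = permute_list \<tau> a' \<and> (a', b) \<in> words n m K" by blast
qed (use words_permute_list_subset[OF assms] in blast)

lemma permute_list_inject:
  assumes "\<tau> permutes {..<length a}" "\<rho> permutes {..<length a}" "distinct a"
    and eq: "permute_list \<tau> a = permute_list \<rho> a"
  shows "\<tau> = \<rho>"
proof
  fix i
  show "\<tau> i = \<rho> i"
  proof (cases "i < length a")
    case True
    hence "\<tau> i < length a" "\<rho> i < length a"
      using permutes_in_image[OF assms(1), of i] permutes_in_image[OF assms(2), of i] by simp_all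
    moreover have "a ! \<tau> i = a ! \<rho> i"
      using True eq by (metis permute_list_nth assms(1,2))
    ultimately show ?thesis using assms(3) by (simp add: nth_eq_iff_index_eq)
  next
    case False
    thus ?thesis using assms(1,2) by (simp add: permutes_def)
  qed
qed

text \<open>Undoing \<open>\<sigma>\<close> leaves a word of \<open>I\<close> with the same
  \<open>b\<close> and the same set of theta letters. Such a word and its superpartition are unique,
  and since its entries are distinct only one permutation turns it into \<open>a\<close>.\<close>

lemma ex1_superpart:
  assumes "length a = m" "length b = n" "0 \<notin> set a" "0 \<notin> set b"
    and dist: "distinct a" and "\<not> null_symmetric a b"
  shows "\<exists>!(\<sigma>, I). \<sigma> permutes {1..m} \<and> I \<in> superparts n m \<and> (a, b) \<in> words n m (permute_blocks m \<sigma> I)"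
proof -
  have len: "m \<le> length I" if "I \<in> superparts n m" for I
    using that by (simp add: superparts_iff supercomps_iff)
  have permuted: "(a, b) \<in> words n m (permute_blocks m \<sigma> I) \<longleftrightarrow>
      (\<exists>a'. a = permute_list (shift_down \<sigma>) a' \<and> (a', b) \<in> words n m I)"
    if "\<sigma> permutes {1..m}" "I \<in> superparts n m" for \<sigma> I
    using that by (simp add: permute_blocks_eq_permute_list words_permute_list shift_down_permutes len)
  obtain a' I where I: "set a' = set a" "distinct a'" "I \<in> superparts n m" "(a', b) \<in> words n m I"
    using ex_superpart assms by blast
  have la': "length a' = m" using I(4) by (simp add: words_iff)
  have "mset a = mset a'" using dist I by (simp add: set_eq_iff_mset_eq_distinct)
  then obtain \<tau> where \<tau>: "\<tau> permutes {..<m}" "permute_list \<tau> a' = a"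
    using mset_eq_permutation la' by metis
  obtain \<sigma> where \<sigma>: "\<sigma> permutes {1..m}" "shift_down \<sigma> = \<tau>" using \<tau>(1) by (rule shift_down_surj)
  show ?thesis
  proof (rule ex1I[of _ "(\<sigma>, I)"], unfold case_prod_conv)
    show "\<sigma> permutes {1..m} \<and> I \<in> superparts n m \<and> (a, b) \<in> words n m (permute_blocks m \<sigma> I)"
      using \<sigma> I \<tau>(2) permuted by blast
  next
    fix z assume z: "case z of (\<sigma>, I) \<Rightarrow>
      \<sigma> permutes {1..m} \<and> I \<in> superparts n m \<and> (a, b) \<in> words n m (permute_blocks m \<sigma> I)"
    obtain \<rho> J where zJ: "z = (\<rho>, J)" by (cases z)
    hence J: "\<rho> permutes {1..m}" "J \<in> superparts n m" using z by auto
    obtain a'' where a'': "a = permute_list (shift_down \<rho>) a''" "(a'', b) \<in> words n m J"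
      using z zJ permuted[OF J] by auto
    have la'': "length a'' = m" using a''(2) by (simp add: words_iff)
    have \<rho>: "shift_down \<rho> permutes {..<length a''}"
      using shift_down_permutes[OF J(1)] la'' by simp
    have "set a'' = set a'" using a''(1) I(1) set_permute_list[OF \<rho>] by simp
    hence "J = I" "a'' = a'" using words_superparts_unique[OF J(2) I(3) a''(2) I(4)] by blast+
    moreover from this have "shift_down \<rho> = shift_down \<sigma>"
      using permute_list_inject[of "shift_down \<rho>" a' \<tau>] \<rho> \<tau> \<sigma> a''(1) la' I(2) by simp
    hence "\<rho> = \<sigma>" using shift_down_inject J(1) \<sigma>(1) by blast
    ultimately show "z = (\<sigma>, I)" using zJ by simp
  qed
qed

section \<open>Monomial functions\<close>

lemma coeff_monomial_fun_sign:
  "coeff (monomial_fun n m K) T c =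
     (\<Sum>a \<in> {a. (a, c) \<in> words n m K \<and> distinct a \<and> set a = T}. theta_sign a)"
  unfolding coeff_monomial_fun
proof (rule sum.reindex_bij_witness[of _ "\<lambda>a. (a, c)" fst])
  fix w assume "w \<in> {(a, b). (a, b) \<in> words n m K \<and> distinct a \<and> set a = T \<and> b = c}"
  then obtain a where a: "w = (a, c)" "(a, c) \<in> words n m K" "distinct a" "set a = T" by auto
  moreover from this have "0 \<notin> set a" "0 \<notin> set c" by (simp_all add: words_iff)
  ultimately show "theta_sign (fst w) = (case w of (a, b) \<Rightarrow> coeff (monom a b) T c)"
    by (simp add: coeff_monom_eq)
qed auto

text \<open>By uniqueness, \<open>a\<close> is the only arrangement of its entries that can
  contribute, and only for \<open>I = J\<close>. This is the duality between monomial functions and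
  coefficients at representative words.\<close>

lemma coeff_monomial_fun_superpart:
  assumes I: "I \<in> superparts n m" and w: "(a, b) \<in> words n m I" and J: "J \<in> superparts n m"
  shows "coeff (monomial_fun n m J) (set a) b = (if I = J then theta_sign a else 0)"
proof -
  have "{a'. (a', b) \<in> words n m J \<and> distinct a' \<and> set a' = set a} = (if I = J then {a} else {})"
    using words_superparts_unique[OF J I _ w] words_superparts_unique(3)[OF I I w w refl] w by auto
  thus ?thesis by (simp add: coeff_monomial_fun_sign)
qed

text \<open>The words on the two sides correspond by rearranging the theta part, and every
  rearrangement multiplies \<open>theta_sign\<close> by the same factor, the sign of
  \<open>\<sigma>\<close>.\<close>

lemma monomial_fun_permute_blocks:
  assumes \<sigma>: "\<sigma> permutes {1..m}" and len: "m \<le> length K"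
  shows "monomial_fun n m (permute_blocks m \<sigma> K) = scale ((-1) ^ inversions m \<sigma>) (monomial_fun n m K)"
proof (rule superseries_eqI)
  fix T c
  define \<tau> where "\<tau> = shift_down \<sigma>"
  have \<tau>: "\<tau> permutes {..<m}" unfolding \<tau>_def by (rule shift_down_permutes[OF \<sigma>])
  have \<tau>': "inv \<tau> permutes {..<m}" using \<tau> by (rule permutes_inv)
  have la: "length a = m" if "(a, c) \<in> words n m K'" for a K' using that by (simp add: words_iff)
  have inv_perm: "permute_list (inv \<tau>) (permute_list \<tau> a) = a" if "length a = m" for a :: "nat list"
    using permute_list_inv[of "inv \<tau>" a] \<tau>' that by (simp add: inv_inv_eq[OF permutes_bij[OF \<tau>]])
  have "coeff (monomial_fun n m (permute_blocks m \<sigma> K)) T c =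
      (\<Sum>a \<in> {a. (a, c) \<in> words n m (permute_list \<tau> K) \<and> distinct a \<and> set a = T}. theta_sign a)"
    by (simp add: coeff_monomial_fun_sign permute_blocks_eq_permute_list[OF \<sigma> len] \<tau>_def)
  also have "\<dots> = (\<Sum>a \<in> {a. (a, c) \<in> words n m K \<and> distinct a \<and> set a = T}.
      (-1) ^ inversions m \<sigma> * theta_sign a)"
  proof (rule sum.reindex_bij_witness[of _ "permute_list \<tau>" "permute_list (inv \<tau>)"])
    fix a assume a: "a \<in> {a. (a, c) \<in> words n m (permute_list \<tau> K) \<and> distinct a \<and> set a = T}"
    then obtain a' where a': "a = permute_list \<tau> a'" "(a', c) \<in> words n m K"
      by (auto simp: words_permute_list[OF \<tau> len])
    have la': "length a' = m" using a'(2) by (rule la)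
    show "permute_list \<tau> (permute_list (inv \<tau>) a) = a"
      using a' la' by (simp add: inv_perm)
    have dist: "distinct a'" "set a' = T" using a a'(1) \<tau> la' by simp_all
    thus "permute_list (inv \<tau>) a \<in> {a. (a, c) \<in> words n m K \<and> distinct a \<and> set a = T}"
      using a' la' by (simp add: inv_perm)
    show "(-1) ^ inversions m \<sigma> * theta_sign (permute_list (inv \<tau>) a) = theta_sign a"
      using theta_sign_permute_list[of \<tau> a'] \<tau> la' dist
      by (simp add: a'(1) inv_perm inversions_shift_down[OF \<sigma>] \<tau>_def[symmetric])
  next
    fix a assume a: "a \<in> {a. (a, c) \<in> words n m K \<and> distinct a \<and> set a = T}"
    hence l: "length a = m" using la by blast
    thus "permute_list (inv \<tau>) (permute_list \<tau> a) = a" by (rule inv_perm)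
    show "permute_list \<tau> a \<in> {a. (a, c) \<in> words n m (permute_list \<tau> K) \<and> distinct a \<and> set a = T}"
      using a l \<tau> by (auto simp: words_permute_list[OF \<tau> len])
  qed
  also have "\<dots> = coeff (scale ((-1) ^ inversions m \<sigma>) (monomial_fun n m K)) T c"
    by (simp add: coeff_monomial_fun_sign sum_distrib_left)
  finally show "coeff (monomial_fun n m (permute_blocks m \<sigma> K)) T c =
    coeff (scale ((-1) ^ inversions m \<sigma>) (monomial_fun n m K)) T c" .
qed

text \<open>Apart from lengths, membership depends only on which letters coincide and on the absence
  of 0; an injective renaming that fixes 0 respects both.\<close>

lemma words_map_iff:
  assumes s: "s permutes {1..N}"
  shows "(map s a, map s b) \<in> words n m K \<longleftrightarrow> (a, b) \<in> words n m K"
proof -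
  have inj: "s x = s y \<longleftrightarrow> x = y" for x y using permutes_inj[OF s] by (auto dest: injD)
  have "s 0 = 0" using permutes_not_in[OF s, of 0] by simp
  hence zero: "s x = 0 \<longleftrightarrow> x = 0" for x using inj[of x 0] by simp
  have img: "0 \<in> s ` A \<longleftrightarrow> 0 \<in> A" for A using zero by (metis image_iff)
  have a: "map s a ! i = s (a ! i)" if "i < m" "length a = m" for i using that by simp
  have b: "map s b ! (j - 1) = s (b ! (j - 1))" if "j \<in> {1..n}" "length b = n" for j using that by auto
  show ?thesis
  proof (cases "length a = m \<and> length b = n")
    case True
    thus ?thesis unfolding words_iff
      by (simp only: a b inj img length_map list.set_map cong: ball_cong conj_cong imp_cong)
  qed (auto simp: words_iff)
qed

lemma rename_monomial_fun:
  assumes s: "s permutes {1..N}"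
  shows "rename s (monomial_fun n m K) = monomial_fun n m K"
proof (rule superseries_eqI)
  fix T c
  let ?f = "monomial_fun n m K"
  show "coeff (rename s ?f) T c = coeff ?f T c"
  proof (cases "finite T \<and> 0 \<notin> T \<and> 0 \<notin> set c")
    case False
    thus ?thesis using coeff_infinite coeff_zero_index by metis
  next
    case True
    have bij: "bij s" using s by (rule permutes_bij)
    have inj: "inj s" using bij by (rule bij_is_inj)
    have surj: "s (inv s x) = x" for x using bij by (simp add: bij_is_surj surj_f_inv_f)
    \<comment> \<open>The monomial is pulled back along \<open>s\<close>. The factor
      \<open>theta_sign (map s a)\<close> carried through the computation accounts for the order of
      \<open>a\<close> and cancels at the end, being nonzero.\<close>
    define b where "b = map (inv s) c"
    define a where "a = sorted_list_of_set (inv s ` T)"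
    have a: "distinct a" "set a = inv s ` T" using True by (simp_all add: a_def)
    have T: "s ` set a = T" and c: "map s b = c" by (simp_all add: a b_def image_image surj o_def)
    have s0: "s 0 = 0" using permutes_not_in[OF s, of 0] by simp
    have pos: "0 \<notin> set a" "0 \<notin> set b" using True T c s0 by (auto simp: rev_image_eqI)
    have "coeff (rename s ?f) T c * theta_sign (map s a) = coeff ?f (set a) b * theta_sign a"
      using coeff_rename_sign[OF s a(1) pos, of ?f] by (simp add: T c)
    also have "\<dots> = (\<Sum>a' \<in> {a'. (a', b) \<in> words n m K \<and> distinct a' \<and> set a' = set a}.
        theta_sign (map s a') * theta_sign (map s a))"
      unfolding coeff_monomial_fun_sign sum_distrib_right
      by (rule sum.cong) (auto simp: theta_sign_ratio[OF _ a(1)] inj_on_subset[OF inj])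
    also have "\<dots> = (\<Sum>a' \<in> {a'. (a', c) \<in> words n m K \<and> distinct a' \<and> set a' = T}.
        theta_sign a' * theta_sign (map s a))"
    proof (rule sum.reindex_bij_witness[of _ "map (inv s)" "map s"])
      fix a' assume a': "a' \<in> {a'. (a', b) \<in> words n m K \<and> distinct a' \<and> set a' = set a}"
      show "map (inv s) (map s a') = a'" using inj by (simp add: o_def)
      show "map s a' \<in> {a'. (a', c) \<in> words n m K \<and> distinct a' \<and> set a' = T}"
        using a' words_map_iff[OF s, of a' b] T c
        by (auto simp: distinct_map inj_on_subset[OF inj])
    next
      fix a' assume a': "a' \<in> {a'. (a', c) \<in> words n m K \<and> distinct a' \<and> set a' = T}"
      show eq: "map s (map (inv s) a') = a'" by (simp add: o_def surj)
      have "inj (inv s)" using bij by (simp add: bij_imp_bij_inv bij_is_inj)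
      thus "map (inv s) a' \<in> {a'. (a', b) \<in> words n m K \<and> distinct a' \<and> set a' = set a}"
        using a' words_map_iff[OF s, of "map (inv s) a'" b] eq c
        by (auto simp: distinct_map a intro: inj_on_subset)
    qed simp
    also have "\<dots> = coeff ?f T c * theta_sign (map s a)"
      by (simp add: coeff_monomial_fun_sign sum_distrib_right)
    finally show ?thesis by simp
  qed
qed

lemma monomial_fun_in_bideg: "monomial_fun n m K \<in> sNCSym_bideg n m"
proof -
  have "length c = n \<and> card T = m" if "coeff (monomial_fun n m K) T c \<noteq> 0" for T c
  proof -
    have "{a. (a, c) \<in> words n m K \<and> distinct a \<and> set a = T} \<noteq> {}"
      using that unfolding coeff_monomial_fun_sign by force
    thus ?thesis by (auto simp: words_iff distinct_card)
  qed
  thus ?thesis by (auto simp: sNCSym_bideg_def sNCSym_def rename_monomial_fun)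
qed

section \<open>Symmetric series\<close>

lemma subspace_sNCSym_bideg: "superseries.subspace (sNCSym_bideg n m)"
proof -
  have "rename s 0 = 0" "rename s (f + g) = rename s f + rename s g"
    "rename s (scale r f) = scale r (rename s f)" if "s permutes {1..N}" for s N f g r
    by (rule superseries_eqI, simp add: coeff_rename[OF that] algebra_simps)+
  hence sub: "superseries.subspace sNCSym" by (auto simp: superseries.subspace_def sNCSym_def)
  show ?thesis unfolding superseries.subspace_def
  proof (intro conjI ballI allI)
    show "0 \<in> sNCSym_bideg n m"
      using sub by (simp add: superseries.subspace_def sNCSym_bideg_def)
  next
    fix f g assume fg: "f \<in> sNCSym_bideg n m" "g \<in> sNCSym_bideg n m"
    hence "f + g \<in> sNCSym"
      using superseries.subspace_add[OF sub] unfolding sNCSym_bideg_def by blast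
    moreover have "length c = n \<and> card T = m" if nz: "coeff (f + g) T c \<noteq> 0" for T c
    proof -
      have "coeff f T c \<noteq> 0 \<or> coeff g T c \<noteq> 0" using nz by auto
      thus ?thesis using fg unfolding sNCSym_bideg_def by blast
    qed
    ultimately show "f + g \<in> sNCSym_bideg n m" unfolding sNCSym_bideg_def by blast
  next
    fix r f assume f: "f \<in> sNCSym_bideg n m"
    hence "scale r f \<in> sNCSym"
      using superseries.subspace_scale[OF sub] unfolding sNCSym_bideg_def by blast
    thus "scale r f \<in> sNCSym_bideg n m" using f unfolding sNCSym_bideg_def by auto
  qed
qed

text \<open>Two theta letters missing from \<open>c\<close> are exchanged by a transposition that
  fixes \<open>c\<close> and \<open>T\<close> but reverses the sign, so the coefficient equals its
  own negative.\<close>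

lemma coeff_null_symmetric:
  assumes f: "f \<in> sNCSym" and null: "card (T - set c) > 1"
  shows "coeff f T c = 0"
proof (cases "finite T \<and> 0 \<notin> T \<and> 0 \<notin> set c")
  case False
  thus ?thesis using coeff_infinite coeff_zero_index by metis
next
  case True
  obtain u v where uv: "u \<in> T - set c" "v \<in> T - set c" "u \<noteq> v"
    using null by (metis One_nat_def card_le_Suc0_iff_eq card.infinite not_le not_less_zero)
  define r where "r = sorted_list_of_set (T - {u, v})"
  define s where "s = transpose u v"
  have r: "distinct r" "set r = T - {u, v}" using True by (simp_all add: r_def)
  have "u \<in> {1..u + v}" "v \<in> {1..u + v}" using uv True by (auto simp: Suc_le_eq intro: gr0I)
  hence s: "s permutes {1..u + v}" unfolding s_def by (rule permutes_swap_id)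
  have "map s r = r" by (rule map_idI) (auto simp: r s_def transpose_def)
  hence a: "map s (u # v # r) = v # u # r" by (simp add: s_def)
  have T: "set (u # v # r) = T" using uv r by auto
  have sT: "s ` T = T" using arg_cong[OF a, of set] T by auto
  have c: "map s c = c" by (rule map_idI) (use uv in \<open>auto simp: s_def transpose_def\<close>)
  have "distinct (u # v # r)" using r uv(3) by simp
  moreover have "0 \<notin> set (u # v # r)" unfolding T using True by blast
  moreover have "rename s f = f" using f s unfolding sNCSym_def by blast
  ultimately have "coeff f T c * theta_sign (v # u # r) = coeff f T c * theta_sign (u # v # r)"
    using coeff_rename_sign[OF s, of "u # v # r" c f] True by (simp only: a T sT c simp_thms)
  \<comment> \<open>Only the factor comparing \<open>u\<close> with \<open>v\<close>
    changes.\<close>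
  moreover have "theta_sign (v # u # r) = - theta_sign (u # v # r)"
    using uv(3) by (auto simp: theta_sign_Cons prod.lessThan_Suc_shift simp del: prod.lessThan_Suc)
  ultimately show ?thesis by simp
qed

text \<open>All words of a superpartition share one equality pattern, so some renaming takes one
  word to the other, and \<open>f\<close> is invariant under it.\<close>

lemma coeff_words_eq:
  assumes f: "f \<in> sNCSym" and I: "I \<in> superparts n m"
    and w: "(a, b) \<in> words n m I" and w': "(a', b') \<in> words n m I"
  shows "coeff f (set a') b' * theta_sign a' = coeff f (set a) b * theta_sign a"
proof -
  have dist: "distinct a" "distinct a'" using words_superparts_unique(3)[OF I I] w w' by blast+
  have len: "length a = m" "length b = n" "length a' = m" "length b' = n"
    and pos: "0 \<notin> set a" "0 \<notin> set b" "0 \<notin> set a'" "0 \<notin> set b'"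
    using w w' by (simp_all add: words_iff)
  have ab: "a ! i = b ! j \<longleftrightarrow> a' ! i = b' ! j" if "i < m" "j < n" for i j
    using w w' that unfolding words_iff ball_atLeast1_conv by simp
  have bb: "b ! i = b ! j \<longleftrightarrow> b' ! i = b' ! j" if "i < n" "j < n" for i j
    using w w' that unfolding words_iff ball_atLeast1_conv by simp
  have "(a @ b) ! i = (a @ b) ! j \<longleftrightarrow> (a' @ b') ! i = (a' @ b') ! j"
    if ij: "i < length (a @ b)" "j < length (a @ b)" for i j
  proof -
    consider "i < m" "j < m" | "i < m" "m \<le> j" | "m \<le> i" "j < m" | "m \<le> i" "m \<le> j" by linarith
    thus ?thesis
    proof cases
      \<comment> \<open>Within the theta parts all letters are distinct, because the blocks of
        \<open>I\<close> are sorted by key.\<close>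
      case 1
      thus ?thesis using len dist by (simp add: nth_append nth_eq_iff_index_eq)
    next
      case 2
      thus ?thesis using len ij ab[of i "j - m"] by (simp add: nth_append)
    next
      case 3
      thus ?thesis using len ij ab[of j "i - m"] by (auto simp: nth_append)
    next
      case 4
      thus ?thesis using len ij bb[of "i - m" "j - m"] by (simp add: nth_append)
    qed
  qed
  moreover have "length (a @ b) = length (a' @ b')" "0 \<notin> set (a @ b)" "0 \<notin> set (a' @ b')"
    using len pos by simp_all
  ultimately obtain N s where s: "s permutes {1..N}" "map s (a @ b) = a' @ b'"
    using extend_to_permutation[of "a @ b" "a' @ b'"] by blast
  hence maps: "map s a = a'" "map s b = b'" using len by simp_all
  hence "s ` set a = set a'" by auto
  thus ?thesis
    using coeff_rename_sign[OF s(1) dist(1) pos(1,2), of f] f s(1) by (simp add: maps sNCSym_def)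
qed

lemma words_nonempty:
  assumes K: "K \<in> supercomps n m"
  shows "words n m K \<noteq> {}"
proof -
  have len: "m \<le> length K"
    and union: "(\<Union>B \<in> set K. B - {0}) = {1..n}"
    and disj: "\<And>i j. i < length K \<Longrightarrow> j < length K \<Longrightarrow> i \<noteq> j \<Longrightarrow> K ! i \<inter> K ! j \<subseteq> {0}"
    using K unfolding supercomps_iff by blast+
  have "\<exists>p < length K. j \<in> K ! p" if "j \<in> {1..n}" for j
  proof -
    have "j \<in> (\<Union>B \<in> set K. B - {0})" unfolding union by (rule that)
    thus ?thesis by (auto simp: in_set_conv_nth)
  qed
  then obtain p where p: "\<And>j. j \<in> {1..n} \<Longrightarrow> p j < length K \<and> j \<in> K ! p j" by metis
  have p_eq: "p j = i \<longleftrightarrow> j \<in> K ! i" if "j \<in> {1..n}" "i < length K" for i j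
    using p[OF that(1)] disj[OF _ that(2), of "p j"] that by auto
  \<comment> \<open>The letter of a block is its list position, raised by 1 to avoid 0. The inner
    \<open>Suc\<close> in \<open>b\<close> turns a list position into an element of
    \<open>{1..n}\<close>.\<close>
  define a where "a = map Suc [0..<m]"
  define b where "b = map (\<lambda>j. Suc (p (Suc j))) [0..<n]"
  have "(a, b) \<in> words n m K" unfolding words_iff
  proof (intro conjI)
    show "\<forall>i < m. \<forall>j \<in> {1..n}. a ! i = b ! (j - 1) \<longleftrightarrow> j \<in> K ! i"
    proof (intro allI impI ballI)
      fix i j assume "i < m" "j \<in> {1..n}"
      thus "a ! i = b ! (j - 1) \<longleftrightarrow> j \<in> K ! i"
        using p_eq[of j i] len by (auto simp: a_def b_def)
    qed
    show "\<forall>j \<in> {1..n}. \<forall>k \<in> {1..n}. b ! (j - 1) = b ! (k - 1) \<longleftrightarrow> (\<exists>B \<in> set K. j \<in> B \<and> k \<in> B)"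
    proof (intro ballI)
      fix j k assume jk: "j \<in> {1..n}" "k \<in> {1..n}"
      hence "b ! (j - 1) = b ! (k - 1) \<longleftrightarrow> p j = p k" by (auto simp: b_def)
      also have "\<dots> \<longleftrightarrow> (\<exists>i < length K. j \<in> K ! i \<and> k \<in> K ! i)"
        using p_eq[OF jk(1)] p_eq[OF jk(2)] p[OF jk(1)] by metis
      also have "\<dots> \<longleftrightarrow> (\<exists>B \<in> set K. j \<in> B \<and> k \<in> B)" by (metis in_set_conv_nth)
      finally show "b ! (j - 1) = b ! (k - 1) \<longleftrightarrow> (\<exists>B \<in> set K. j \<in> B \<and> k \<in> B)" .
    qed
  qed (auto simp: a_def b_def)
  thus ?thesis by blast
qed

text \<open>Null-symmetric coefficients vanish by symmetry. Every other monomial of this bidegree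
  is, up to sign, a word of some superpartition, and there one zero coefficient forces all the
  others.\<close>

lemma sNCSym_bideg_eq_zero:
  assumes g: "g \<in> sNCSym_bideg n m"
    and zero: "\<And>I. I \<in> superparts n m \<Longrightarrow> \<exists>a b. (a, b) \<in> words n m I \<and> coeff g (set a) b = 0"
  shows "g = 0"
proof (rule superseries_eqI, rule ccontr)
  fix T c assume "coeff g T c \<noteq> coeff 0 T c"
  hence nz: "coeff g T c \<noteq> 0" by simp
  have sym: "g \<in> sNCSym" and deg: "length c = n" "card T = m"
    using g nz by (auto simp: sNCSym_bideg_def)
  have pos: "finite T" "0 \<notin> T" "0 \<notin> set c"
    using nz coeff_infinite coeff_zero_index by blast+
  define a where "a = sorted_list_of_set T"
  have a: "set a = T" "distinct a" "length a = m" using pos deg by (simp_all add: a_def)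
  have "\<not> null_symmetric a c"
    using coeff_null_symmetric[OF sym] nz by (auto simp: null_symmetric_def a(1))
  then obtain a' I where I: "set a' = T" "I \<in> superparts n m" "(a', c) \<in> words n m I"
    using ex_superpart[of a m c n] a pos deg by metis
  obtain a'' b where w: "(a'', b) \<in> words n m I" "coeff g (set a'') b = 0"
    using zero[OF I(2)] by blast
  show False using coeff_words_eq[OF sym I(2) w(1) I(3)] w(2) nz I(1) by simp
qed

section \<open>Spanning and independence via dual functionals\<close>

theorem proposition3p4:
  fixes n m :: nat
  assumes "m \<le> n + 1"
  shows
    "(\<forall>a b. length a = m \<and> length b = n \<and> 0 \<notin> set a \<and> 0 \<notin> set b \<and> distinct a \<and> \<not> null_symmetric a b
        \<longrightarrow> (\<exists>!(\<sigma>, I). \<sigma> permutes {1..m} \<and> I \<in> superparts n m \<and> (a, b) \<in> words n m (permute_blocks m \<sigma> I)))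
   \<and> superseries.span {monomial_fun n m (permute_blocks m \<sigma> I) | \<sigma> I. \<sigma> permutes {1..m} \<and> I \<in> superparts n m}
        = sNCSym_bideg n m
   \<and> (\<forall>I \<in> superparts n m. \<forall>\<sigma>. \<sigma> permutes {1..m}
        \<longrightarrow> monomial_fun n m (permute_blocks m \<sigma> I) = scale ((-1) ^ inversions m \<sigma>) (monomial_fun n m I))
   \<and> inj_on (monomial_fun n m) (superparts n m)
   \<and> superseries.independent (monomial_fun n m ` superparts n m)
   \<and> superseries.span (monomial_fun n m ` superparts n m) = sNCSym_bideg n m"
proof (intro conjI)
  let ?M = "monomial_fun n m" and ?P = "superparts n m"
  \<comment> \<open>One representative word for each superpartition.\<close>
  define W where "W I = (SOME w. w \<in> words n m I)" for I
  have W: "(fst (W I), snd (W I)) \<in> words n m I" if "I \<in> ?P" for I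
    using words_nonempty[of I n m] that by (simp add: W_def some_in_eq superparts_iff)
  \<comment> \<open>The factor \<open>theta_sign\<close> normalises the functional to the value 1 at
    \<open>?M I\<close>.\<close>
  define ev where "ev f I = coeff f (set (fst (W I))) (snd (W I)) * theta_sign (fst (W I))" for f I
  have ev_M: "ev (?M J) I = (if I = J then 1 else 0)" if "I \<in> ?P" "J \<in> ?P" for I J
    using coeff_monomial_fun_superpart[OF that(1) W[OF that(1)] that(2)] by (simp add: ev_def)
  have ev_lin: "ev 0 I = 0" "ev (f + g) I = ev f I + ev g I" "ev (f - g) I = ev f I - ev g I"
    "ev (scale r f) I = r * ev f I" for f g r I
    by (simp_all add: ev_def algebra_simps)
  have ev_sum: "ev (\<Sum>x \<in> A. scale (h x) (F x)) I = (\<Sum>x \<in> A. h x * ev (F x) I)"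
    for A :: "nat set list set" and h F I
    by (induction A rule: infinite_finite_induct) (simp_all add: ev_lin)
  have ev_comb: "ev (\<Sum>J \<in> ?P. scale (h J) (?M J)) I = h I" if "I \<in> ?P" for h I
  proof -
    have "ev (\<Sum>J \<in> ?P. scale (h J) (?M J)) I = (\<Sum>J \<in> ?P. if J = I then h J else 0)"
      unfolding ev_sum by (rule sum.cong) (auto simp: ev_M that)
    thus ?thesis using that finite_superparts by simp
  qed
  \<comment> \<open>If two different superpartitions had the same monomial function,
    \<open>ev\<close> at the first would be both 1 and 0.\<close>
  show inj: "inj_on ?M ?P"
    by (rule inj_onI) (metis ev_M zero_neq_one)
  show "superseries.independent (?M ` ?P)"
  proof (rule superseries.independent_if_scalars_zero)
    fix h x assume sum: "(\<Sum>x \<in> ?M ` ?P. scale (h x) x) = 0" and "x \<in> ?M ` ?P"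
    then obtain I where I: "I \<in> ?P" "x = ?M I" by blast
    have "(\<Sum>J \<in> ?P. scale (h (?M J)) (?M J)) = 0"
      using sum by (simp add: sum.reindex[OF inj])
    thus "h x = 0" using ev_comb[OF I(1), of "\<lambda>J. h (?M J)"] I(2) by (simp add: ev_lin)
  qed (simp add: finite_superparts)
  have "f \<in> superseries.span (?M ` ?P)" if f: "f \<in> sNCSym_bideg n m" for f
  proof -
    \<comment> \<open>Duality dictates the coefficients \<open>ev f J\<close>. The difference
      \<open>f - ?g\<close> is then killed by every functional and hence is zero.\<close>
    let ?g = "\<Sum>J \<in> ?P. scale (ev f J) (?M J)"
    have g_span: "?g \<in> superseries.span (?M ` ?P)"
      by (intro superseries.span_sum superseries.span_scale superseries.span_base) blast
    have "?g \<in> sNCSym_bideg n m"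
      by (intro superseries.subspace_sum superseries.subspace_scale subspace_sNCSym_bideg
          monomial_fun_in_bideg)
    hence "f - ?g \<in> sNCSym_bideg n m"
      using f superseries.subspace_diff[OF subspace_sNCSym_bideg] by blast
    hence "f - ?g = 0"
    proof (rule sNCSym_bideg_eq_zero)
      fix I assume I: "I \<in> ?P"
      have "ev (f - ?g) I = 0" using I by (simp add: ev_lin ev_comb)
      hence "coeff (f - ?g) (set (fst (W I))) (snd (W I)) = 0"
        by (simp only: ev_def mult_eq_0_iff theta_sign_nonzero simp_thms)
      thus "\<exists>a b. (a, b) \<in> words n m I \<and> coeff (f - ?g) (set a) b = 0" using W[OF I] by blast
    qed
    thus ?thesis using g_span by simp
  qed
  moreover have "superseries.span (?M ` ?P) \<subseteq> sNCSym_bideg n m"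
    by (rule superseries.span_minimal[OF _ subspace_sNCSym_bideg]) (auto simp: monomial_fun_in_bideg)
  ultimately show span: "superseries.span (?M ` ?P) = sNCSym_bideg n m" by blast
  have sign: "?M (permute_blocks m \<sigma> I) = scale ((-1) ^ inversions m \<sigma>) (?M I)"
    if "I \<in> ?P" "\<sigma> permutes {1..m}" for \<sigma> I
    using that by (intro monomial_fun_permute_blocks) (simp_all add: superparts_iff supercomps_iff)
  thus "\<forall>I \<in> ?P. \<forall>\<sigma>. \<sigma> permutes {1..m} \<longrightarrow>
      ?M (permute_blocks m \<sigma> I) = scale ((-1) ^ inversions m \<sigma>) (?M I)" by blast
  let ?S = "{?M (permute_blocks m \<sigma> I) | \<sigma> I. \<sigma> permutes {1..m} \<and> I \<in> ?P}"
  show "superseries.span ?S = sNCSym_bideg n m"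
  proof
    show "superseries.span ?S \<subseteq> sNCSym_bideg n m"
      by (rule superseries.span_minimal[OF _ subspace_sNCSym_bideg]) (auto simp: monomial_fun_in_bideg)
    \<comment> \<open>The identity permutation puts the basis inside the larger family.\<close>
    have "?M I \<in> ?S" if I: "I \<in> ?P" for I
    proof -
      have "permute_blocks m id I = I"
        using I permute_blocks_eq_permute_list[OF permutes_id, of m I]
        by (simp add: shift_down_id superparts_iff supercomps_iff)
      thus ?thesis using I permutes_id[of "{1..m}"] by (metis (mono_tags, lifting) mem_Collect_eq)
    qed
    hence "?M ` ?P \<subseteq> ?S" by blast
    thus "sNCSym_bideg n m \<subseteq> superseries.span ?S"
      unfolding span[symmetric] by (rule superseries.span_mono)
  qed
  show "\<forall>a b. length a = m \<and> length b = n \<and> 0 \<notin> set a \<and> 0 \<notin> set b \<and> distinct a \<and> \<not> null_symmetric a b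
      \<longrightarrow> (\<exists>!(\<sigma>, I). \<sigma> permutes {1..m} \<and> I \<in> ?P \<and> (a, b) \<in> words n m (permute_blocks m \<sigma> I))"
    using ex1_superpart by blast
qed

end
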